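(* Let $(M^{2m},J,g)$ be a standard Kähler manifold and let $(T^{*}M,{}^{BS}g)$ be its cotangent bundle equipped with the Berger-type deformed Sasaki metric. For a curve $\gamma$ on $M$, the curve $C=(\gamma(t),\widetilde{\gamma'(t)})$ is a geodesic on $(T^{*}M,{}^{BS}g)$ if and only if $\gamma$ is a geodesic on $(M^{2m},J,g)$.
   Context: All objects are smooth. A standard Kähler manifold $(M^{2m},J,g)$ is a $2m$-dimensional manifold with an almost complex structure $J$ ($J^2=-I$) and a Riemannian metric $g$ with $g(JX,JY)=g(X,Y)$ such that $\nabla J=0$, where $\nabla$ is the Levi-Civita connection of $g$. For a vector $X$, $\widetilde X$ is the covector $\widetilde X(Y)=g(X,Y)$; for a covector $\omega$, $\widetilde\omega$ is the vector with $g(\widetilde\omega,X)=\omega(X)$ for all $X$; $g^{-1}(\omega,\theta)=g(\widetilde\omega,\widetilde\theta)$; $\omega J$ is the covector $(\omega J)(X)=\omega(JX)$. In the coordinates $(x^i,p_i)$ on $T^{*}M$ induced by coordinates $(x^i)$ on $M$, with Christoffel symbols $\Gamma^k_{ij}$ of $g$, the horizontal lift of $X=X^i\partial_{x^i}$ is ${}^{H}X=X^{i}\partial_{x^i}+p_{h}\Gamma^{h}_{ij}X^{j}\partial_{p_i}$ and the vertical lift of $\omega=\omega_idx^i$ is ${}^{V}\omega=\omega_i\partial_{p_i}$. The Berger-type deformed Sasaki metric ${}^{BS}g$ on $T^{*}M$, with real constant $\delta$, is the Riemannian metric defined at $(x,p)$ by ${}^{BS}g({}^{H}X,{}^{H}Y)=g(X,Y)$,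 ${}^{BS}g({}^{H}X,{}^{V}\theta)=0$, ${}^{BS}g({}^{V}\omega,{}^{V}\theta)=g^{-1}(\omega,\theta)+\delta^{2}g^{-1}(\omega,pJ)\,g^{-1}(\theta,pJ)$. A curve on $T^{*}M$ is written $C=(\gamma(t),\vartheta(t))$ with $\gamma$ a curve on $M$ and $\vartheta$ a covector field along $\gamma$; $\gamma'=\frac{d\gamma}{dt}$. *)

theory Defs
  imports "HOL-Analysis.Analysis"
begin

section \<open>Smooth maps between Euclidean spaces\<close>

text \<open>Intended for open \<open>S\<close>: the derivative is the unrestricted one.\<close>

fun Ck_on :: "nat \<Rightarrow> ('a::euclidean_space \<Rightarrow> 'b::real_normed_vector) \<Rightarrow> 'a set \<Rightarrow> bool" where
  "Ck_on 0 f S \<longleftrightarrow> continuous_on S f"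
| "Ck_on (Suc k) f S \<longleftrightarrow>
     (\<forall>x\<in>S. f differentiable (at x)) \<and> (\<forall>v. Ck_on k (\<lambda>x. frechet_derivative f (at x) v) S)"

definition smooth_on :: "('a::euclidean_space \<Rightarrow> 'b::real_normed_vector) \<Rightarrow> 'a set \<Rightarrow> bool" where
  "smooth_on f S \<longleftrightarrow> (\<forall>k. Ck_on k f S)"

definition partial_deriv :: "'n::finite \<Rightarrow> (real^'n \<Rightarrow> real) \<Rightarrow> real^'n \<Rightarrow> real" where
  "partial_deriv i f x = frechet_derivative f (at x) (axis i 1)"


section \<open>Smooth manifolds\<close>

text \<open>
  An atlas is a family of charts indexed by the type \<open>'i\<close>. The manifold is the union of the chart
  domains; points of \<open>'a\<close> outside this union play no role. The dimension is \<open>CARD('n)\<close>.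
\<close>

record ('i, 'a, 'n) atlas =
  chart_dom :: "'i \<Rightarrow> 'a set"
  chart_map :: "'i \<Rightarrow> 'a \<Rightarrow> real^'n"

definition points :: "('i, 'a, 'n::finite) atlas \<Rightarrow> 'a set" where
  "points A = (\<Union>i. chart_dom A i)"

definition chart_image :: "('i, 'a, 'n::finite) atlas \<Rightarrow> 'i \<Rightarrow> (real^'n) set" where
  "chart_image A i = chart_map A i ` chart_dom A i"

definition transition ::
  "('i, 'a, 'n::finite) atlas \<Rightarrow> 'i \<Rightarrow> 'i \<Rightarrow> real^'n \<Rightarrow> real^'n" where
  "transition A i j = chart_map A j \<circ> inv_into (chart_dom A i) (chart_map A i)"

text \<open>Entry \<open>$ a $ b\<close> is \<open>\<partial>y\<^sup>a/\<partial>x\<^sup>b\<close>, where \<open>x\<close> are the coordinates of chart \<open>i\<close>, \<open>y\<close> those of \<open>j\<close>.\<close>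

definition chart_change ::
  "('i, 'a, 'n::finite) atlas \<Rightarrow> 'i \<Rightarrow> 'i \<Rightarrow> 'a \<Rightarrow> real^'n^'n" where
  "chart_change A i j q = jacobian (transition A i j) (at (chart_map A i q))"

definition atlas_open :: "('i, 'a, 'n::finite) atlas \<Rightarrow> 'a set \<Rightarrow> bool" where
  "atlas_open A V \<longleftrightarrow> V \<subseteq> points A \<and> (\<forall>i. open (chart_map A i ` (V \<inter> chart_dom A i)))"

definition atlas_topology :: "('i, 'a, 'n::finite) atlas \<Rightarrow> 'a topology" where
  "atlas_topology A = topology (atlas_open A)"

definition smooth_manifold :: "('i, 'a, 'n::finite) atlas \<Rightarrow> bool" where
  "smooth_manifold A \<longleftrightarrow>
     (\<forall>i. inj_on (chart_map A i) (chart_dom A i) \<and> open (chart_image A i)) \<and>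
     (\<forall>i j. open (chart_map A i ` (chart_dom A i \<inter> chart_dom A j)) \<and>
            smooth_on (transition A i j) (chart_map A i ` (chart_dom A i \<inter> chart_dom A j))) \<and>
     Hausdorff_space (atlas_topology A) \<and> second_countable (atlas_topology A)"

lemma openin_atlas_topology:
  assumes "\<And>i. inj_on (chart_map A i) (chart_dom A i)"
  shows "openin (atlas_topology A) = atlas_open A"
proof -
  have "istopology (atlas_open A)"
    unfolding istopology_def
  proof (intro conjI allI impI)
    fix S T assume S: "atlas_open A S" and T: "atlas_open A T"
    have "chart_map A i ` (S \<inter> T \<inter> chart_dom A i) =
            chart_map A i ` (S \<inter> chart_dom A i) \<inter> chart_map A i ` (T \<inter> chart_dom A i)" for i
      using inj_on_image_Int[OF assms[of i], of "S \<inter> chart_dom A i" "T \<inter> chart_dom A i"]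
      by (simp add: Int_ac)
    with S T show "atlas_open A (S \<inter> T)"
      by (auto simp: atlas_open_def)
  next
    fix K assume K: "\<forall>S\<in>K. atlas_open A S"
    have "chart_map A i ` (\<Union>K \<inter> chart_dom A i) = (\<Union>S\<in>K. chart_map A i ` (S \<inter> chart_dom A i))" for i
      by blast
    with K show "atlas_open A (\<Union>K)"
      by (auto simp: atlas_open_def)
  qed
  then show ?thesis
    by (simp add: atlas_topology_def)
qed


section \<open>Curves\<close>

definition smooth_curve ::
  "('i, 'a, 'n::finite) atlas \<Rightarrow> real set \<Rightarrow> (real \<Rightarrow> 'a) \<Rightarrow> bool" where
  "smooth_curve A I \<gamma> \<longleftrightarrow>
     \<gamma> ` I \<subseteq> points A \<and>
     (\<forall>i. open {t \<in> I. \<gamma> t \<in> chart_dom A i} \<and>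
          smooth_on (chart_map A i \<circ> \<gamma>) {t \<in> I. \<gamma> t \<in> chart_dom A i})"

text \<open>
  A tangent vector at \<open>q\<close> is represented by the family of its coordinate columns in all the charts,
  with value 0 in the charts whose domain does not contain \<open>q\<close>.
\<close>

definition velocity ::
  "('i, 'a, 'n::finite) atlas \<Rightarrow> (real \<Rightarrow> 'a) \<Rightarrow> real \<Rightarrow> 'i \<Rightarrow> real^'n" where
  "velocity A \<gamma> t i =
     (if \<gamma> t \<in> chart_dom A i then vector_derivative (chart_map A i \<circ> \<gamma>) (at t) else 0)"


section \<open>Riemannian metrics and geodesics\<close>

text \<open>
  A tensor field is given by its components in every chart, as functions of the coordinates, subject
  to the tensorial transformation law. A metric has components \<open>g i x $ a $ b = g\<^sub>a\<^sub>b\<close>; an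
  endomorphism field has components \<open>J i x $ a $ b = J\<^sup>a\<^sub>b\<close>, so that it maps \<open>X\<close> to \<open>J i x *v X\<close>.
\<close>

definition riemannian_metric ::
  "('i, 'a, 'n::finite) atlas \<Rightarrow> ('i \<Rightarrow> real^'n \<Rightarrow> real^'n^'n) \<Rightarrow> bool" where
  "riemannian_metric A g \<longleftrightarrow>
     (\<forall>i. smooth_on (g i) (chart_image A i)) \<and>
     (\<forall>i. \<forall>x\<in>chart_image A i.
        transpose (g i x) = g i x \<and> (\<forall>X. X \<noteq> 0 \<longrightarrow> X \<bullet> (g i x *v X) > 0)) \<and>
     (\<forall>i j. \<forall>q\<in>chart_dom A i \<inter> chart_dom A j.
        g i (chart_map A i q) =
          transpose (chart_change A i j q) ** g j (chart_map A j q) ** chart_change A i j q)"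

text \<open>\<open>christoffel h x k i j\<close> is \<open>\<Gamma>\<^sup>k\<^sub>i\<^sub>j\<close> of the metric with components \<open>h\<close>.\<close>

definition christoffel ::
  "(real^'n::finite \<Rightarrow> real^'n^'n) \<Rightarrow> real^'n \<Rightarrow> 'n \<Rightarrow> 'n \<Rightarrow> 'n \<Rightarrow> real" where
  "christoffel h x k i j =
     (\<Sum>l\<in>UNIV. matrix_inv (h x) $ k $ l *
        (partial_deriv i (\<lambda>y. h y $ j $ l) x + partial_deriv j (\<lambda>y. h y $ i $ l) x
         - partial_deriv l (\<lambda>y. h y $ i $ j) x)) / 2"

text \<open>The components of \<open>\<nabla>\<^bsub>\<gamma>'\<^esub>\<gamma>'\<close> in chart \<open>i\<close>.\<close>

definition covariant_acceleration ::
  "('i, 'a, 'n::finite) atlas \<Rightarrow> ('i \<Rightarrow> real^'n \<Rightarrow> real^'n^'n) \<Rightarrow>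
   (real \<Rightarrow> 'a) \<Rightarrow> real \<Rightarrow> 'i \<Rightarrow> real^'n" where
  "covariant_acceleration A g \<gamma> t i = (\<chi> k.
     vector_derivative (\<lambda>s. velocity A \<gamma> s i) (at t) $ k +
     (\<Sum>a\<in>UNIV. \<Sum>b\<in>UNIV. christoffel (g i) (chart_map A i (\<gamma> t)) k a b *
        velocity A \<gamma> t i $ a * velocity A \<gamma> t i $ b))"

definition geodesic ::
  "('i, 'a, 'n::finite) atlas \<Rightarrow> ('i \<Rightarrow> real^'n \<Rightarrow> real^'n^'n) \<Rightarrow>
   real set \<Rightarrow> (real \<Rightarrow> 'a) \<Rightarrow> bool" where
  "geodesic A g I \<gamma> \<longleftrightarrow>
     smooth_curve A I \<gamma> \<and>
     (\<forall>t\<in>I. \<forall>i. \<gamma> t \<in> chart_dom A i \<longrightarrow> covariant_acceleration A g \<gamma> t i = 0)"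


section \<open>Kaehler manifolds\<close>

definition endomorphism_field ::
  "('i, 'a, 'n::finite) atlas \<Rightarrow> ('i \<Rightarrow> real^'n \<Rightarrow> real^'n^'n) \<Rightarrow> bool" where
  "endomorphism_field A J \<longleftrightarrow>
     (\<forall>i. smooth_on (J i) (chart_image A i)) \<and>
     (\<forall>i j. \<forall>q\<in>chart_dom A i \<inter> chart_dom A j.
        chart_change A i j q ** J i (chart_map A i q) =
          J j (chart_map A j q) ** chart_change A i j q)"

text \<open>The component \<open>(\<nabla>\<^sub>kJ)\<^sup>a\<^sub>b\<close>, with \<open>h\<close> the components of the metric.\<close>

definition covariant_deriv_endo ::
  "(real^'n::finite \<Rightarrow> real^'n^'n) \<Rightarrow> (real^'n \<Rightarrow> real^'n^'n) \<Rightarrow> real^'n \<Rightarrow>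
   'n \<Rightarrow> 'n \<Rightarrow> 'n \<Rightarrow> real" where
  "covariant_deriv_endo h J x k a b =
     partial_deriv k (\<lambda>y. J y $ a $ b) x
     + (\<Sum>l\<in>UNIV. christoffel h x a k l * J x $ l $ b)
     - (\<Sum>l\<in>UNIV. christoffel h x l k b * J x $ a $ l)"

definition kaehler_manifold ::
  "('i, 'a, 'n::finite) atlas \<Rightarrow> ('i \<Rightarrow> real^'n \<Rightarrow> real^'n^'n) \<Rightarrow>
   ('i \<Rightarrow> real^'n \<Rightarrow> real^'n^'n) \<Rightarrow> bool" where
  "kaehler_manifold A J g \<longleftrightarrow>
     smooth_manifold A \<and> endomorphism_field A J \<and> riemannian_metric A g \<and>
     (\<forall>i. \<forall>x\<in>chart_image A i.
        J i x ** J i x = - mat 1 \<and>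
        (\<forall>X Y. (J i x *v X) \<bullet> (g i x *v (J i x *v Y)) = X \<bullet> (g i x *v Y)) \<and>
        (\<forall>k a b. covariant_deriv_endo (g i) (J i) x k a b = 0))"


section \<open>The cotangent bundle\<close>

text \<open>A covector at \<open>q\<close> is represented like a tangent vector, with the dual transformation law.\<close>

definition cotangent_space ::
  "('i, 'a, 'n::finite) atlas \<Rightarrow> 'a \<Rightarrow> ('i \<Rightarrow> real^'n) set" where
  "cotangent_space A q =
     {p. (\<forall>i. q \<notin> chart_dom A i \<longrightarrow> p i = 0) \<and>
         (\<forall>i j. q \<in> chart_dom A i \<inter> chart_dom A j \<longrightarrow> p i = transpose (chart_change A i j q) *v p j)}"

text \<open>
  Coordinates \<open>(x\<^sup>i, p\<^sub>i)\<close> are collected in a vector indexed by \<open>'n + 'n\<close>: \<open>Inl i\<close> stands for \<open>x\<^sup>i\<close>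
  and \<open>Inr i\<close> for \<open>p\<^sub>i\<close>.
\<close>

definition join :: "real^'n::finite \<Rightarrow> real^'n \<Rightarrow> real^('n + 'n)" where
  "join x p = (\<chi> k. case k of Inl i \<Rightarrow> x $ i | Inr i \<Rightarrow> p $ i)"

definition base_part :: "real^('n::finite + 'n) \<Rightarrow> real^'n" where
  "base_part z = (\<chi> i. z $ Inl i)"

definition fibre_part :: "real^('n::finite + 'n) \<Rightarrow> real^'n" where
  "fibre_part z = (\<chi> i. z $ Inr i)"

definition cotangent_bundle ::
  "('i, 'a, 'n::finite) atlas \<Rightarrow> ('i, 'a \<times> ('i \<Rightarrow> real^'n), 'n + 'n) atlas" where
  "cotangent_bundle A =
     \<lparr>chart_dom = (\<lambda>i. {(q, p). q \<in> chart_dom A i \<and> p \<in> cotangent_space A q}),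
      chart_map = (\<lambda>i (q, p). join (chart_map A i q) (p i))\<rparr>"

text \<open>The covector \<open>Y \<mapsto> g(X, Y)\<close> of a tangent vector \<open>X\<close> at \<open>q\<close>.\<close>

definition flat ::
  "('i, 'a, 'n::finite) atlas \<Rightarrow> ('i \<Rightarrow> real^'n \<Rightarrow> real^'n^'n) \<Rightarrow> 'a \<Rightarrow>
   ('i \<Rightarrow> real^'n) \<Rightarrow> 'i \<Rightarrow> real^'n" where
  "flat A g q X i = (if q \<in> chart_dom A i then X i v* g i (chart_map A i q) else 0)"


section \<open>The Berger-type deformed Sasaki metric\<close>

text \<open>
  Everything is expressed in one chart: \<open>h\<close> and \<open>J\<close> are the components of the metric and of the
  almost complex structure there, \<open>x\<close> the coordinates of the base point and \<open>p\<close> the components of the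
  covector.
\<close>

definition sharp :: "(real^'n::finite \<Rightarrow> real^'n^'n) \<Rightarrow> real^'n \<Rightarrow> real^'n \<Rightarrow> real^'n" where
  "sharp h x \<omega> = matrix_inv (h x) *v \<omega>"

definition cometric :: "(real^'n::finite \<Rightarrow> real^'n^'n) \<Rightarrow> real^'n \<Rightarrow> real^'n \<Rightarrow> real^'n \<Rightarrow> real" where
  "cometric h x \<omega> \<theta> = sharp h x \<omega> \<bullet> (h x *v sharp h x \<theta>)"

definition horizontal_lift ::
  "(real^'n::finite \<Rightarrow> real^'n^'n) \<Rightarrow> real^'n \<Rightarrow> real^'n \<Rightarrow> real^'n \<Rightarrow> real^('n + 'n)" where
  "horizontal_lift h x p X =
     join X (\<chi> i. \<Sum>l\<in>UNIV. \<Sum>j\<in>UNIV. p $ l * christoffel h x l i j * X $ j)"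

definition vertical_lift :: "real^'n::finite \<Rightarrow> real^('n + 'n)" where
  "vertical_lift \<omega> = join 0 \<omega>"

definition vertical_component ::
  "(real^'n::finite \<Rightarrow> real^'n^'n) \<Rightarrow> real^'n \<Rightarrow> real^'n \<Rightarrow> real^('n + 'n) \<Rightarrow> real^'n" where
  "vertical_component h x p W = fibre_part (W - horizontal_lift h x p (base_part W))"

text \<open>
  Every tangent vector \<open>W\<close> of the cotangent bundle is the sum of the horizontal lift of \<open>base_part W\<close>
  and the vertical lift of \<open>vertical_component h x p W\<close>; the metric is prescribed on such lifts.
\<close>

definition berger_sasaki_form ::
  "(real^'n::finite \<Rightarrow> real^'n^'n) \<Rightarrow> (real^'n \<Rightarrow> real^'n^'n) \<Rightarrow> real \<Rightarrow> real^'n \<Rightarrow> real^'n \<Rightarrow>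
   real^('n + 'n) \<Rightarrow> real^('n + 'n) \<Rightarrow> real" where
  "berger_sasaki_form h J \<delta> x p W Z =
     (let \<omega> = vertical_component h x p W; \<theta> = vertical_component h x p Z; pJ = p v* J x
      in base_part W \<bullet> (h x *v base_part Z) + cometric h x \<omega> \<theta>
         + \<delta>\<^sup>2 * cometric h x \<omega> pJ * cometric h x \<theta> pJ)"

definition berger_sasaki_metric ::
  "('i \<Rightarrow> real^'n::finite \<Rightarrow> real^'n^'n) \<Rightarrow> ('i \<Rightarrow> real^'n \<Rightarrow> real^'n^'n) \<Rightarrow> real \<Rightarrow>
   'i \<Rightarrow> real^('n + 'n) \<Rightarrow> real^('n + 'n)^('n + 'n)" where
  "berger_sasaki_metric J g \<delta> i z =
     (\<chi> a b. berger_sasaki_form (g i) (J i) \<delta> (base_part z) (fibre_part z) (axis a 1) (axis b 1))"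

lemma base_part_join [simp]: "base_part (join x p) = x"
  by (simp add: base_part_def join_def)

lemma fibre_part_join [simp]: "fibre_part (join x p) = p"
  by (simp add: fibre_part_def join_def)

lemma lift_decomposition:
  "W = horizontal_lift h x p (base_part W) + vertical_lift (vertical_component h x p W)"
  by (simp add: vec_eq_iff vertical_lift_def vertical_component_def horizontal_lift_def join_def
      base_part_def fibre_part_def split: sum.split)

lemma base_part_horizontal_lift [simp]: "base_part (horizontal_lift h x p X) = X"
  by (simp add: horizontal_lift_def)

lemma vertical_component_horizontal_lift [simp]:
  "vertical_component h x p (horizontal_lift h x p X) = 0"
  by (simp add: vertical_component_def fibre_part_def vec_eq_iff)

lemma base_part_vertical_lift [simp]: "base_part (vertical_lift \<omega>) = 0"
  by (simp add: vertical_lift_def)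

lemma vertical_component_vertical_lift [simp]:
  "vertical_component h x p (vertical_lift \<omega>) = \<omega>"
  by (simp add: vertical_component_def horizontal_lift_def fibre_part_def vec_eq_iff
      vertical_lift_def join_def base_part_def)

lemma linear_base_part: "linear base_part"
  by (rule linearI) (simp_all add: base_part_def vec_eq_iff)

lemma linear_vertical_component: "linear (vertical_component h x p)"
  by (rule linearI)
    (simp_all add: vertical_component_def horizontal_lift_def fibre_part_def base_part_def
      join_def vec_eq_iff algebra_simps sum.distrib sum_distrib_left)

lemma bilinear_cometric: "bilinear (cometric h x)"
  unfolding bilinear_def cometric_def sharp_def
  by (auto intro!: linearI simp: inner_simps matrix_vector_right_distrib
      matrix_vector_mult_scaleR)

lemma bilinear_berger_sasaki_form: "bilinear (berger_sasaki_form h J \<delta> x p)"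
proof -
  note lin = linear_add[OF linear_base_part] linear_scale[OF linear_base_part]
    linear_add[OF linear_vertical_component] linear_scale[OF linear_vertical_component]
    bilinear_ladd[OF bilinear_cometric] bilinear_radd[OF bilinear_cometric]
    bilinear_lmul[OF bilinear_cometric] bilinear_rmul[OF bilinear_cometric]
  show ?thesis
    unfolding bilinear_def berger_sasaki_form_def Let_def
    by (auto intro!: linearI simp: lin inner_simps matrix_vector_right_distrib
        matrix_vector_mult_scaleR algebra_simps)
qed

lemma berger_sasaki_metric_form:
  fixes J g :: "'i \<Rightarrow> real^'n::finite \<Rightarrow> real^'n^'n"
  shows "W \<bullet> (berger_sasaki_metric J g \<delta> i (join x p) *v Z) = berger_sasaki_form (g i) (J i) \<delta> x p W Z"
proof -
  let ?B = "berger_sasaki_form (g i) (J i) \<delta> x p"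
  have *: "U = (\<Sum>a\<in>UNIV. (U $ a) *\<^sub>R axis a 1)" for U :: "real^('n + 'n)"
    using basis_expansion[of U] by (simp add: scalar_mult_eq_scaleR)
  have "?B W Z = ?B (\<Sum>a\<in>UNIV. (W $ a) *\<^sub>R axis a 1) (\<Sum>b\<in>UNIV. (Z $ b) *\<^sub>R axis b 1)"
    by (subst *[of W], subst *[of Z]) (rule refl)
  also have "\<dots> = (\<Sum>(a, b)\<in>UNIV \<times> UNIV. ?B ((W $ a) *\<^sub>R axis a 1) ((Z $ b) *\<^sub>R axis b 1))"
    by (rule bilinear_sum[OF bilinear_berger_sasaki_form])
  also have "\<dots> = (\<Sum>a\<in>UNIV. \<Sum>b\<in>UNIV. W $ a * (Z $ b * ?B (axis a 1) (axis b 1)))"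
    by (simp add: sum.cartesian_product bilinear_lmul[OF bilinear_berger_sasaki_form]
        bilinear_rmul[OF bilinear_berger_sasaki_form] mult.left_commute)
  also have "\<dots> = W \<bullet> (berger_sasaki_metric J g \<delta> i (join x p) *v Z)"
    by (simp add: inner_vec_def matrix_vector_mult_def berger_sasaki_metric_def
        sum_distrib_left mult_ac)
  finally show ?thesis ..
qed

text \<open>The three identities that prescribe the metric, and the fact that they determine it.\<close>

theorem berger_sasaki_metric_lifts:
  fixes J g :: "'i \<Rightarrow> real^'n::finite \<Rightarrow> real^'n^'n" and p x :: "real^'n" and i :: 'i and \<delta> :: real
  defines "G \<equiv> berger_sasaki_metric J g \<delta> i (join x p)"
  shows "horizontal_lift (g i) x p X \<bullet> (G *v horizontal_lift (g i) x p Y) = X \<bullet> (g i x *v Y)"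
    and "horizontal_lift (g i) x p X \<bullet> (G *v vertical_lift \<theta>) = 0"
    and "vertical_lift \<omega> \<bullet> (G *v vertical_lift \<theta>) =
           cometric (g i) x \<omega> \<theta>
           + \<delta>\<^sup>2 * cometric (g i) x \<omega> (p v* J i x) * cometric (g i) x \<theta> (p v* J i x)"
  by (simp_all add: G_def berger_sasaki_metric_form berger_sasaki_form_def Let_def
      bilinear_lzero[OF bilinear_cometric] bilinear_rzero[OF bilinear_cometric])

theorem berger_sasaki_metric_unique:
  fixes J g :: "'i \<Rightarrow> real^'n::finite \<Rightarrow> real^'n^'n" and p :: "real^'n"
  assumes "transpose G = G"
    and "\<And>X Y. horizontal_lift (g i) x p X \<bullet> (G *v horizontal_lift (g i) x p Y) = X \<bullet> (g i x *v Y)"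
    and "\<And>X \<theta>. horizontal_lift (g i) x p X \<bullet> (G *v vertical_lift \<theta>) = 0"
    and "\<And>\<omega> \<theta>. vertical_lift \<omega> \<bullet> (G *v vertical_lift \<theta>) =
           cometric (g i) x \<omega> \<theta>
           + \<delta>\<^sup>2 * cometric (g i) x \<omega> (p v* J i x) * cometric (g i) x \<theta> (p v* J i x)"
  shows "G = berger_sasaki_metric J g \<delta> i (join x p)"
proof -
  have sym: "U \<bullet> (G *v V) = V \<bullet> (G *v U)" for U V
    using assms(1) by (metis dot_lmul_matrix inner_commute transpose_matrix_vector)
  have "W \<bullet> (G *v Z) = berger_sasaki_form (g i) (J i) \<delta> x p W Z" for W Z
    by (subst lift_decomposition[of W "g i" x p], subst lift_decomposition[of Z "g i" x p])
      (simp add: inner_add_left inner_add_right matrix_vector_right_distrib assms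
        sym[of "vertical_lift _" "horizontal_lift _ _ _ _"] berger_sasaki_form_def Let_def)
  then have "W \<bullet> (G *v Z) = W \<bullet> (berger_sasaki_metric J g \<delta> i (join x p) *v Z)" for W Z
    by (simp add: berger_sasaki_metric_form)
  then show ?thesis
    by (metis matrix_eq vector_eq_rdot inner_commute)
qed

end

theory Submission
  imports Defs
begin

text \<open>
  Write \<open>a = \<nabla>\<^bsub>\<gamma>'\<^esub>\<gamma>'\<close> and \<open>\<nu> = g(a, J\<gamma>')\<close>. The geodesic equation of a metric \<open>G\<close> is its Euler--Lagrange
  equation \<open>d/dt (z' \<bullet> G W) = z' \<bullet> G W' + (D\<^sub>W G)(z', z') / 2\<close>, which avoids the Christoffel symbols of
  the deformed Sasaki metric and all curvature terms.

  If the lift is a geodesic, testing with the vertical lift of \<open>a\<close> shows that \<open>|a|\<^sup>2 + \<delta>\<^sup>2\<nu>\<^sup>2\<close> is constant,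
  so by conservation of the total energy \<open>|\<gamma>'|\<^sup>2 + |a|\<^sup>2 + \<delta>\<^sup>2\<nu>\<^sup>2\<close> the speed is constant, that is,
  \<open>g(a, \<gamma>') = 0\<close>. Testing with the vertical lift of \<open>\<gamma>'\<close> then gives \<open>|a|\<^sup>2 + 2\<delta>\<^sup>2\<nu>\<^sup>2 = 0\<close>, hence \<open>a = 0\<close>.

  Conversely, if \<open>a = 0\<close>, the velocity of the lift is horizontal, and since the vertical part of the
  metric is a nonnegative quadratic form vanishing on it, that part does not contribute to the
  Euler--Lagrange equation, which reduces to the one for \<open>\<gamma>\<close>.
\<close>

section \<open>Smooth maps\<close>

lemma Ck_on_cong:
  assumes "open S" "\<And>x. x \<in> S \<Longrightarrow> f x = g x" "Ck_on k f S"
  shows "Ck_on k g S"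
  using assms(2,3)
proof (induction k arbitrary: f g)
  case 0
  have "continuous_on S f"
    using 0(2) by simp
  then have "continuous_on S g"
    by (rule continuous_on_eq) (rule 0(1))
  then show ?case by simp
next
  case (Suc k)
  have *: "(g has_derivative frechet_derivative f (at x)) (at x)" if "x \<in> S" for x
  proof (rule has_derivative_transform_within_open[OF _ \<open>open S\<close> that])
    show "(f has_derivative frechet_derivative f (at x)) (at x)"
      using Suc.prems(2) that unfolding frechet_derivative_works[symmetric] by simp
  qed (rule Suc.prems(1))
  then have eq: "frechet_derivative g (at x) = frechet_derivative f (at x)" if "x \<in> S" for x
    using that frechet_derivative_at by metis
  have "Ck_on k (\<lambda>x. frechet_derivative g (at x) v) S" for v
  proof (rule Suc.IH[of "\<lambda>x. frechet_derivative f (at x) v"])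
    show "Ck_on k (\<lambda>x. frechet_derivative f (at x) v) S"
      using Suc.prems(2) by simp
  qed (simp add: eq)
  moreover have "g differentiable (at x)" if "x \<in> S" for x
    using *[OF that] by (rule differentiableI)
  ultimately show ?case by simp
qed

declare Ck_on.simps(2) [simp del]

text \<open>Derivatives are unique on an open set, so any explicit derivative \<open>f'\<close> may
  stand for \<open>frechet_derivative\<close>.\<close>

lemma Ck_on_SucI:
  assumes "open S" "\<And>x. x \<in> S \<Longrightarrow> (f has_derivative f' x) (at x)" "\<And>v. Ck_on k (\<lambda>x. f' x v) S"
  shows "Ck_on (Suc k) f S"
proof -
  have "frechet_derivative f (at x) = f' x" if "x \<in> S" for x
    using that frechet_derivative_at[OF assms(2)] by metis
  then have "Ck_on k (\<lambda>x. frechet_derivative f (at x) v) S" for v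
    by (intro Ck_on_cong[OF assms(1) _ assms(3)[of v]]) auto
  then show ?thesis
    using differentiableI[OF assms(2)] by (simp add: Ck_on.simps(2))
qed

lemma Ck_on_Suc_has_derivative:
  "Ck_on (Suc k) f S \<Longrightarrow> x \<in> S \<Longrightarrow> (f has_derivative frechet_derivative f (at x)) (at x)"
  by (simp add: frechet_derivative_works[symmetric] Ck_on.simps(2))

lemma Ck_on_derivative: "Ck_on (Suc k) f S \<Longrightarrow> Ck_on k (\<lambda>x. frechet_derivative f (at x) v) S"
  by (simp add: Ck_on.simps(2))

lemma Ck_on_SucD: "Ck_on (Suc k) f S \<Longrightarrow> Ck_on k f S"
proof (induction k arbitrary: f)
  case 0
  then show ?case
    by (auto simp: Ck_on.simps(2) intro!: differentiable_imp_continuous_on differentiable_at_imp_differentiable_on)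
next
  case (Suc k)
  have "\<forall>x\<in>S. f differentiable (at x)"
    using Suc.prems by (simp add: Ck_on.simps(2)[of "Suc k"])
  moreover have "Ck_on k (\<lambda>x. frechet_derivative f (at x) v) S" for v
    by (intro Suc.IH Ck_on_derivative Suc.prems)
  ultimately show ?case by (simp add: Ck_on.simps(2)[of k])
qed

lemma Ck_on_const: "open S \<Longrightarrow> Ck_on k (\<lambda>_. c) S"
proof (induction k arbitrary: c)
  case (Suc k)
  then show ?case by (intro Ck_on_SucI[where f' = "\<lambda>_ _. 0"]) auto
qed auto

lemma Ck_on_bounded_linear:
  assumes "open S" "bounded_linear L" "Ck_on k f S"
  shows "Ck_on k (\<lambda>x. L (f x)) S"
  using assms(3)
proof (induction k arbitrary: f)
  case 0
  then show ?case using bounded_linear.continuous_on[OF assms(2)] by auto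
next
  case (Suc k)
  show ?case
    by (rule Ck_on_SucI[OF \<open>open S\<close> bounded_linear.has_derivative[OF assms(2)
              Ck_on_Suc_has_derivative[OF Suc.prems]]])
      (assumption | rule Suc.IH Ck_on_derivative Suc.prems)+
qed

lemma Ck_on_add:
  assumes "open S" "Ck_on k f S" "Ck_on k g S"
  shows "Ck_on k (\<lambda>x. f x + g x) S"
  using assms(2,3)
proof (induction k arbitrary: f g)
  case 0
  then show ?case using continuous_on_add by auto
next
  case (Suc k)
  show ?case
    by (rule Ck_on_SucI[OF \<open>open S\<close> has_derivative_add[OF
              Ck_on_Suc_has_derivative[OF Suc.prems(1)] Ck_on_Suc_has_derivative[OF Suc.prems(2)]]])
      (assumption | rule Suc.IH Ck_on_derivative Suc.prems)+
qed

lemma Ck_on_sum: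
  assumes "open S" "finite B" "\<And>b. b \<in> B \<Longrightarrow> Ck_on k (f b) S"
  shows "Ck_on k (\<lambda>x. \<Sum>b\<in>B. f b x) S"
  using assms(2,3)
  by (induction B) (auto intro!: Ck_on_add Ck_on_const assms(1))

text \<open>The product rule yields two terms of the same bilinear shape, hence the induction over
  arbitrary f and g; the undifferentiated factor is lowered one order by
  \<open>Ck_on_SucD\<close>.\<close>

lemma Ck_on_bounded_bilinear:
  assumes "open S" "bounded_bilinear B" "Ck_on k f S" "Ck_on k g S"
  shows "Ck_on k (\<lambda>x. B (f x) (g x)) S"
  using assms(3,4)
proof (induction k arbitrary: f g)
  case 0
  then show ?case using bounded_bilinear.continuous_on[OF assms(2)] by auto
next
  case (Suc k)
  show ?case
  proof (rule Ck_on_SucI[OF \<open>open S\<close> bounded_bilinear.FDERIV[OF assms(2)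
              Ck_on_Suc_has_derivative[OF Suc.prems(1)] Ck_on_Suc_has_derivative[OF Suc.prems(2)]]])
    show "Ck_on k (\<lambda>x. B (f x) (frechet_derivative g (at x) v) +
        B (frechet_derivative f (at x) v) (g x)) S" for v
      by (intro Ck_on_add Suc.IH \<open>open S\<close> Ck_on_derivative Suc.prems Ck_on_SucD[OF Suc.prems(1)]
          Ck_on_SucD[OF Suc.prems(2)])
  qed
qed

lemma Ck_on_compose:
  assumes "open S" "open U" "g ` S \<subseteq> U" "Ck_on k f U" "Ck_on k g S"
  shows "Ck_on k (\<lambda>x. f (g x)) S"
  using assms(4,5)
proof (induction k arbitrary: f)
  case 0
  then show ?case using assms(3) by (auto intro: continuous_on_compose2)
next
  case (Suc k)
  \<comment> \<open>In the chain rule the direction in which f is differentiated depends on x,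
    whereas \<open>Ck_on\<close> speaks of fixed directions. Expanding it in the basis gives scalar
    functions times \<open>frechet_derivative f (at (g x)) b\<close>, to which the induction
    hypothesis applies.\<close>
  let ?F = "\<lambda>x v. \<Sum>b\<in>Basis. (frechet_derivative g (at x) v \<bullet> b) *\<^sub>R frechet_derivative f (at (g x)) b"
  show ?case
  proof (rule Ck_on_SucI[OF \<open>open S\<close>])
    fix x assume "x \<in> S"
    then have "g x \<in> U" using assms(3) by auto
    note f = Ck_on_Suc_has_derivative[OF Suc.prems(1) this]
    note g = Ck_on_Suc_has_derivative[OF Suc.prems(2) \<open>x \<in> S\<close>]
    have lin: "linear (frechet_derivative f (at (g x)))"
      using f by (rule has_derivative_linear)
    have "frechet_derivative f (at (g x)) (frechet_derivative g (at x) v) =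
      frechet_derivative f (at (g x)) (\<Sum>b\<in>Basis. (frechet_derivative g (at x) v \<bullet> b) *\<^sub>R b)" for v
      by (simp only: euclidean_representation)
    also have "frechet_derivative f (at (g x)) (\<Sum>b\<in>Basis. (frechet_derivative g (at x) v \<bullet> b) *\<^sub>R b) = ?F x v" for v
      by (simp add: linear_sum[OF lin] linear_scale[OF lin] o_def)
    finally have "frechet_derivative f (at (g x)) (frechet_derivative g (at x) v) = ?F x v" for v .
    then show "((\<lambda>x. f (g x)) has_derivative ?F x) (at x)"
      using diff_chain_at[OF g f] by (simp add: o_def)
  next
    fix v
    show "Ck_on k (\<lambda>x. ?F x v) S"
      by (intro Ck_on_sum Ck_on_bounded_bilinear[OF _ bounded_bilinear_scaleR] \<open>open S\<close> Suc.IH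
          Ck_on_bounded_linear[OF _ bounded_linear_inner_left] finite_Basis Ck_on_derivative
          Suc.prems Ck_on_SucD[OF Suc.prems(2)])
  qed
qed

section \<open>Christoffel symbols\<close>

lemma bounded_bilinear_matrix_vector_mult: "bounded_bilinear ((*v) :: real^'n^'m \<Rightarrow> _)"
  unfolding bilinear_conv_bounded_bilinear[symmetric] bilinear_def
  by (auto intro!: linearI simp: matrix_vector_mult_add_rdistrib matrix_vector_right_distrib
      matrix_vector_mult_scaleR scaleR_matrix_vector_assoc)

lemma vec_component_has_derivative:
  assumes "(f has_derivative f') F"
  shows "((\<lambda>y. f y $ i) has_derivative (\<lambda>v. f' v $ i)) F"
  by (rule bounded_linear.has_derivative[OF bounded_linear_vec_nth assms])

lemma differentiable_vec_component:
  "f differentiable F \<Longrightarrow> (\<lambda>y. f y $ i) differentiable F"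
  unfolding differentiable_def using vec_component_has_derivative by blast

lemma differentiable_vec_lambda:
  fixes f :: "'a::real_normed_vector \<Rightarrow> 'n::finite \<Rightarrow> 'b::euclidean_space"
  assumes "\<And>i. (\<lambda>y. f y i) differentiable (at x)"
  shows "(\<lambda>y. \<chi> i. f y i) differentiable (at x)"
proof (subst differentiable_componentwise_within, intro ballI)
  fix b :: "'b^'n" assume "b \<in> Basis"
  then obtain i c where b: "b = axis i c" by (auto simp: Basis_vec_def)
  show "(\<lambda>y. (\<chi> i. f y i) \<bullet> b) differentiable (at x)"
    by (simp add: b inner_axis assms)
qed

lemma has_derivative_eq_frechet:
  "(f has_derivative f') (at x) \<Longrightarrow> frechet_derivative f (at x) = f'"
  by (rule frechet_derivative_at[symmetric])

lemma partial_deriv_component: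
  assumes "h differentiable (at x)"
  shows "partial_deriv b (\<lambda>y. h y $ j $ l) x = frechet_derivative h (at x) (axis b 1) $ j $ l"
  using has_derivative_eq_frechet[OF vec_component_has_derivative[OF vec_component_has_derivative[OF
        assms[unfolded frechet_derivative_works], of j], of l]]
  by (simp add: partial_deriv_def)

text \<open>Bridge between the coordinate partials in \<open>christoffel\<close> and
  \<open>covariant_deriv_endo\<close> and an invariant trilinear form; used for the metric and for
  J.\<close>

lemma inner_frechet_derivative:
  assumes "h differentiable (at x)"
  shows "X \<bullet> (frechet_derivative h (at x) V *v Y) =
    (\<Sum>a\<in>UNIV. \<Sum>j\<in>UNIV. \<Sum>l\<in>UNIV. V $ a * X $ j * Y $ l * partial_deriv a (\<lambda>y. h y $ j $ l) x)"
proof -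
  have lin: "linear (frechet_derivative h (at x))"
    using assms by (rule linear_frechet_derivative)
  have *: "V = (\<Sum>a\<in>UNIV. (V $ a) *\<^sub>R axis a 1)"
    using basis_expansion[of V] by (simp add: scalar_mult_eq_scaleR)
  have "frechet_derivative h (at x) V = (\<Sum>a\<in>UNIV. (V $ a) *\<^sub>R frechet_derivative h (at x) (axis a 1))"
    by (subst *) (simp add: linear_sum[OF lin] linear_scale[OF lin] o_def)
  then have "X \<bullet> (frechet_derivative h (at x) V *v Y) =
    (\<Sum>j\<in>UNIV. \<Sum>l\<in>UNIV. \<Sum>a\<in>UNIV. V $ a * X $ j * Y $ l * partial_deriv a (\<lambda>y. h y $ j $ l) x)"
    by (simp add: inner_vec_def matrix_vector_mult_def partial_deriv_component[OF assms]
        sum_distrib_left sum_distrib_right mult_ac)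
  also have "\<dots> = (\<Sum>j\<in>UNIV. \<Sum>a\<in>UNIV. \<Sum>l\<in>UNIV. V $ a * X $ j * Y $ l * partial_deriv a (\<lambda>y. h y $ j $ l) x)"
    by (intro sum.cong refl sum.swap)
  also have "\<dots> = (\<Sum>a\<in>UNIV. \<Sum>j\<in>UNIV. \<Sum>l\<in>UNIV. V $ a * X $ j * Y $ l * partial_deriv a (\<lambda>y. h y $ j $ l) x)"
    by (rule sum.swap)
  finally show ?thesis .
qed

text \<open>The bilinear map \<Gamma>(U, V) of the chart:
  \<open>Y' + christoffel_form h x x' Y\<close> is the covariant derivative of a vector field Y
  along a curve x.\<close>

definition christoffel_form ::
  "(real^'n::finite \<Rightarrow> real^'n^'n) \<Rightarrow> real^'n \<Rightarrow> real^'n \<Rightarrow> real^'n \<Rightarrow> real^'n" where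
  "christoffel_form h x U V = (\<chi> k. \<Sum>a\<in>UNIV. \<Sum>b\<in>UNIV. christoffel h x k a b * U $ a * V $ b)"

lemma matrix_inv_works:
  assumes "invertible (M :: real^'n^'n)"
  shows "M ** matrix_inv M = mat 1" "matrix_inv M ** M = mat 1"
  using someI_ex[OF assms[unfolded invertible_def]] unfolding matrix_inv_def by auto

lemma matrix_inv_vector:
  assumes "invertible (M :: real^'n^'n)"
  shows "M *v (matrix_inv M *v X) = X" "matrix_inv M *v (M *v X) = X"
  by (simp_all add: matrix_vector_mul_assoc matrix_inv_works[OF assms])

text \<open>The Koszul formula for constant coordinate fields. Multiplying by \<open>h x\<close>
  cancels the inverse matrix in \<open>christoffel\<close>, so only derivatives of h remain.\<close>

lemma christoffel_form_lowered:
  assumes "h differentiable (at x)" "invertible (h x)"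
  shows "W \<bullet> (h x *v christoffel_form h x U V) =
    (V \<bullet> (frechet_derivative h (at x) U *v W) + U \<bullet> (frechet_derivative h (at x) V *v W)
      - U \<bullet> (frechet_derivative h (at x) W *v V)) / 2"
proof -
  define d where "d a j l = partial_deriv a (\<lambda>y. h y $ j $ l) x" for a j l
  \<comment> \<open>The Christoffel symbols of the first kind contracted with U and V.\<close>
  define q where "q = (\<chi> l. \<Sum>a\<in>UNIV. \<Sum>b\<in>UNIV. (d a b l + d b a l - d l a b) / 2 * U $ a * V $ b)"
  have "christoffel_form h x U V $ k = (matrix_inv (h x) *v q) $ k" for k
  proof -
    let ?f = "\<lambda>l a b. matrix_inv (h x) $ k $ l * ((d a b l + d b a l - d l a b) / 2 * U $ a * V $ b)"
    have "christoffel_form h x U V $ k = (\<Sum>a\<in>UNIV. \<Sum>b\<in>UNIV. \<Sum>l\<in>UNIV. ?f l a b)"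
      by (simp add: christoffel_form_def christoffel_def d_def[symmetric] sum_distrib_right
          sum_distrib_left sum_divide_distrib mult_ac)
    also have "\<dots> = (\<Sum>a\<in>UNIV. \<Sum>l\<in>UNIV. \<Sum>b\<in>UNIV. ?f l a b)"
      by (intro sum.cong refl sum.swap)
    also have "\<dots> = (\<Sum>l\<in>UNIV. \<Sum>a\<in>UNIV. \<Sum>b\<in>UNIV. ?f l a b)"
      by (rule sum.swap)
    finally show ?thesis
      by (simp add: matrix_vector_mult_def q_def sum_distrib_left)
  qed
  then have "christoffel_form h x U V = matrix_inv (h x) *v q"
    by (simp add: vec_eq_iff)
  then have "W \<bullet> (h x *v christoffel_form h x U V) = W \<bullet> q"
    by (simp add: matrix_inv_vector[OF assms(2)])
  also have "\<dots> = ((\<Sum>l\<in>UNIV. \<Sum>a\<in>UNIV. \<Sum>b\<in>UNIV. U $ a * V $ b * W $ l * d a b l)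
      + (\<Sum>l\<in>UNIV. \<Sum>a\<in>UNIV. \<Sum>b\<in>UNIV. V $ b * U $ a * W $ l * d b a l)
      - (\<Sum>l\<in>UNIV. \<Sum>a\<in>UNIV. \<Sum>b\<in>UNIV. W $ l * U $ a * V $ b * d l a b)) / 2"
    by (simp add: q_def inner_vec_def sum_distrib_left sum.distrib[symmetric] sum_subtractf[symmetric]
        sum_divide_distrib, intro sum.cong refl) (simp add: algebra_simps add_divide_distrib diff_divide_distrib)
  also have "(\<Sum>l\<in>UNIV. \<Sum>a\<in>UNIV. \<Sum>b\<in>UNIV. U $ a * V $ b * W $ l * d a b l) =
      (\<Sum>a\<in>UNIV. \<Sum>l\<in>UNIV. \<Sum>b\<in>UNIV. U $ a * V $ b * W $ l * d a b l)"
    by (rule sum.swap)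
  also have "\<dots> = (\<Sum>a\<in>UNIV. \<Sum>b\<in>UNIV. \<Sum>l\<in>UNIV. U $ a * V $ b * W $ l * d a b l)"
    by (intro sum.cong refl sum.swap)
  also have "(\<Sum>l\<in>UNIV. \<Sum>a\<in>UNIV. \<Sum>b\<in>UNIV. V $ b * U $ a * W $ l * d b a l) =
      (\<Sum>l\<in>UNIV. \<Sum>b\<in>UNIV. \<Sum>a\<in>UNIV. V $ b * U $ a * W $ l * d b a l)"
    by (intro sum.cong refl sum.swap)
  also have "\<dots> = (\<Sum>b\<in>UNIV. \<Sum>l\<in>UNIV. \<Sum>a\<in>UNIV. V $ b * U $ a * W $ l * d b a l)"
    by (rule sum.swap)
  also have "\<dots> = (\<Sum>b\<in>UNIV. \<Sum>a\<in>UNIV. \<Sum>l\<in>UNIV. V $ b * U $ a * W $ l * d b a l)"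
    by (intro sum.cong refl sum.swap)
  finally show ?thesis
    by (simp only: inner_frechet_derivative[OF assms(1)] d_def)
qed

section \<open>Differentiability of the inverse matrix by Cramer's rule\<close>

lemma differentiable_det:
  fixes f :: "'a::real_normed_vector \<Rightarrow> real^'n^'n"
  assumes "\<And>i j. (\<lambda>y. f y $ i $ j) differentiable (at x)"
  shows "(\<lambda>y. det (f y)) differentiable (at x)"
proof -
  have "(\<lambda>y. \<Prod>i\<in>UNIV. f y $ i $ p i) differentiable (at x)" for p
    by (rule differentiableI, rule has_derivative_prod, rule assms[unfolded frechet_derivative_works])
  then show ?thesis
    unfolding det_def by (intro differentiable_sum differentiable_mult differentiable_const) auto
qed

lemma differentiable_matrix_inv:
  fixes f :: "'a::real_normed_vector \<Rightarrow> real^'n^'n"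
  assumes "f differentiable (at x)" "invertible (f x)"
  shows "(\<lambda>y. matrix_inv (f y) $ k $ l) differentiable (at x)"
proof -
  \<comment> \<open>Cramer's quotient for coordinate k of the solution z of
    \<open>f y *v z = axis l 1\<close>, that is, for entry (k, l) of the inverse. It is valid where
    \<open>det (f y)\<close> is nonzero, hence near x by continuity.\<close>
  let ?g = "\<lambda>y. det (\<chi> i j. if j = k then axis l 1 $ i else f y $ i $ j) / det (f y)"
  have f: "(\<lambda>y. f y $ i $ j) differentiable (at x)" for i j
    by (intro differentiable_vec_component assms)
  have det: "(\<lambda>y. det (f y)) differentiable (at x)"
    using f by (rule differentiable_det)
  have "(\<lambda>y. det (\<chi> i j. if j = k then axis l 1 $ i else f y $ i $ j)) differentiable (at x)"
  proof (rule differentiable_det)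
    show "(\<lambda>y. (\<chi> i j. if j = k then axis l 1 $ i else f y $ i $ j) $ i' $ j') differentiable (at x)" for i' j'
      by (cases "j' = k") (simp_all add: f)
  qed
  with det assms(2) have "?g differentiable (at x)"
    by (intro differentiable_divide) (simp_all add: invertible_det_nz)
  moreover have "\<forall>\<^sub>F y in at x. ?g y = matrix_inv (f y) $ k $ l"
  proof -
    have "((\<lambda>y. det (f y)) \<longlongrightarrow> det (f x)) (at x)"
      using differentiable_imp_continuous_within[OF det] by (simp add: continuous_within)
    then have "\<forall>\<^sub>F y in at x. det (f y) \<noteq> 0"
      using assms(2) by (intro tendsto_imp_eventually_ne) (simp_all add: invertible_det_nz)
    then show ?thesis
    proof eventually_elim
      case (elim y)
      then have "f y *v (matrix_inv (f y) *v axis l 1) = axis l 1"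
        by (intro matrix_inv_vector) (simp add: invertible_det_nz)
      with cramer[OF elim, of "matrix_inv (f y) *v axis l 1" "axis l 1"]
      have "(matrix_inv (f y) *v axis l 1) $ k = ?g y"
        by simp
      then show ?case
        by (simp add: matrix_vector_mult_basis column_def)
    qed
  qed
  \<comment> \<open>The filter \<open>at x\<close> omits x, so the values at x are compared
    separately.\<close>
  moreover have "?g x = matrix_inv (f x) $ k $ l"
  proof -
    have "f x *v (matrix_inv (f x) *v axis l 1) = axis l 1"
      by (intro matrix_inv_vector assms)
    with cramer[of "f x" "matrix_inv (f x) *v axis l 1" "axis l 1"] assms(2)
    have "(matrix_inv (f x) *v axis l 1) $ k = ?g x"
      by (simp add: invertible_det_nz)
    then show ?thesis
      by (simp add: matrix_vector_mult_basis column_def)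
  qed
  ultimately show ?thesis
    using differentiableI[OF has_derivative_transform_eventually[of ?g _ x UNIV]]
    by (simp add: frechet_derivative_works)
qed

text \<open>Matches the index order of \<open>horizontal_lift\<close>: the free index i there is the
  one contracted with U.\<close>

lemma christoffel_form_component_sum:
  "p \<bullet> christoffel_form h x U V = (\<Sum>i\<in>UNIV. U $ i * (\<Sum>l\<in>UNIV. \<Sum>j\<in>UNIV. p $ l * christoffel h x l i j * V $ j))"
proof -
  have "p \<bullet> christoffel_form h x U V =
      (\<Sum>l\<in>UNIV. \<Sum>i\<in>UNIV. U $ i * (\<Sum>j\<in>UNIV. p $ l * christoffel h x l i j * V $ j))"
    by (simp add: inner_vec_def christoffel_form_def sum_distrib_left mult_ac)
  also have "\<dots> = (\<Sum>i\<in>UNIV. \<Sum>l\<in>UNIV. U $ i * (\<Sum>j\<in>UNIV. p $ l * christoffel h x l i j * V $ j))"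
    by (rule sum.swap)
  finally show ?thesis by (simp add: sum_distrib_left)
qed

text \<open>For the velocity of a curve (x, p) in the bundle the right side is the covariant
  derivative of p along x, evaluated on Y.\<close>

lemma vertical_component_inner:
  "vertical_component h x p W \<bullet> Y = fibre_part W \<bullet> Y - p \<bullet> christoffel_form h x Y (base_part W)"
  unfolding christoffel_form_component_sum
  by (simp add: vertical_component_def horizontal_lift_def join_def fibre_part_def
      inner_vec_def right_diff_distrib left_diff_distrib sum_subtractf mult_ac)

lemma bilinear_christoffel_form: "bilinear (christoffel_form h x)"
  unfolding bilinear_def
  by (auto intro!: linearI simp: christoffel_form_def vec_eq_iff algebra_simps sum.distrib sum_distrib_left)

section \<open>Metrics and parallel complex structures in a chart\<close>

lemma differentiable_transform_open:
  assumes "open S" "x \<in> S" "\<And>y. y \<in> S \<Longrightarrow> f y = g y" "f differentiable (at x)"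
  shows "g differentiable (at x)"
  by (rule differentiableI, rule has_derivative_transform_within_open[OF _ assms(1,2,3)])
    (rule assms(4)[unfolded frechet_derivative_works])

lemma smooth_on_has_derivative:
  "smooth_on f S \<Longrightarrow> x \<in> S \<Longrightarrow> (f has_derivative frechet_derivative f (at x)) (at x)"
  unfolding smooth_on_def using Ck_on_Suc_has_derivative by blast

lemma smooth_on_differentiable: "smooth_on f S \<Longrightarrow> x \<in> S \<Longrightarrow> f differentiable (at x)"
  using smooth_on_has_derivative differentiableI by blast

lemma smooth_on_frechet_derivative:
  "smooth_on f S \<Longrightarrow> smooth_on (\<lambda>x. frechet_derivative f (at x) v) S"
  unfolding smooth_on_def using Ck_on_derivative by blast

lemma has_vector_derivative_compose:
  assumes "(x has_vector_derivative v) (at t)" "f differentiable (at (x t))"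
  shows "((\<lambda>s. f (x s)) has_vector_derivative frechet_derivative f (at (x t)) v) (at t)"
proof -
  have "(f has_derivative frechet_derivative f (at (x t))) (at (x t))"
    using assms(2) by (simp add: frechet_derivative_works)
  from diff_chain_at[OF assms(1)[unfolded has_vector_derivative_def] this]
    linear_scale[OF has_derivative_linear[OF this]]
  show ?thesis
    by (simp add: has_vector_derivative_def o_def)
qed

lemma has_vector_derivative_matrix_vector:
  fixes M :: "'a::euclidean_space \<Rightarrow> real^'n^'m"
  assumes "(x has_vector_derivative v) (at t)" "M differentiable (at (x t))"
    and "(Y has_vector_derivative Y') (at t)"
  shows "((\<lambda>s. M (x s) *v Y s) has_vector_derivative
    (M (x t) *v Y' + frechet_derivative M (at (x t)) v *v Y t)) (at t)"
  by (rule bounded_bilinear.has_vector_derivative[OF bounded_bilinear_matrix_vector_mult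
        has_vector_derivative_compose[OF assms(1,2)] assms(3)])

lemma has_real_derivative_metric_product:
  fixes M :: "'a::euclidean_space \<Rightarrow> real^'n^'m"
  assumes "(x has_vector_derivative v) (at t)" "M differentiable (at (x t))"
    and "(Y has_vector_derivative Y') (at t)" "(Z has_vector_derivative Z') (at t)"
  shows "((\<lambda>s. Y s \<bullet> (M (x s) *v Z s)) has_real_derivative
    (Y' \<bullet> (M (x t) *v Z t) + Y t \<bullet> (frechet_derivative M (at (x t)) v *v Z t) + Y t \<bullet> (M (x t) *v Z'))) (at t)"
  using bounded_bilinear.has_vector_derivative[OF bounded_bilinear_inner assms(3)
      has_vector_derivative_matrix_vector[OF assms(1,2,4)]]
  by (simp add: has_real_derivative_iff_has_vector_derivative inner_add_right add_ac)

lemma inner_matrix_symmetric: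
  assumes "transpose (M :: real^'n^'n) = M"
  shows "X \<bullet> (M *v Y) = Y \<bullet> (M *v X)"
  using assms by (metis dot_lmul_matrix inner_commute transpose_matrix_vector)

lemma positive_definite_imp_invertible:
  fixes M :: "real^'n^'n"
  assumes "\<And>X. X \<noteq> 0 \<Longrightarrow> X \<bullet> (M *v X) > 0"
  shows "invertible M"
proof -
  have "inj ((*v) M)"
    unfolding linear_injective_0[OF matrix_vector_mul_linear]
    using assms by (metis inner_zero_right less_irrefl)
  then obtain B where "B ** M = mat 1"
    using matrix_left_invertible_injective[of M] by auto
  then show ?thesis
    using matrix_left_right_inverse unfolding invertible_def by blast
qed

section \<open>Levi-Civita calculus in one chart\<close>

locale metric_chart =
  fixes U :: "(real^'n::finite) set" and h :: "real^'n \<Rightarrow> real^'n^'n"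
  assumes open_U: "open U" and smooth_h: "smooth_on h U"
    and sym: "\<And>x. x \<in> U \<Longrightarrow> transpose (h x) = h x"
    and pos: "\<And>x X. x \<in> U \<Longrightarrow> X \<noteq> 0 \<Longrightarrow> X \<bullet> (h x *v X) > 0"
begin

lemma h_differentiable: "x \<in> U \<Longrightarrow> h differentiable (at x)"
  using smooth_h by (rule smooth_on_differentiable)

lemma h_invertible: "x \<in> U \<Longrightarrow> invertible (h x)"
  using pos by (rule positive_definite_imp_invertible)

lemma h_commute: "x \<in> U \<Longrightarrow> X \<bullet> (h x *v Y) = Y \<bullet> (h x *v X)"
  using inner_matrix_symmetric[OF sym] .

lemma h_nonneg: "x \<in> U \<Longrightarrow> X \<bullet> (h x *v X) \<ge> 0"
  using pos[of x X] by (cases "X = 0") auto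

text \<open>The identity \<open>transpose (h y) = h y\<close> holds on the open set U and
  transposition is linear, so the derivative inherits it by uniqueness.\<close>

lemma frechet_derivative_h_commute:
  assumes "x \<in> U"
  shows "X \<bullet> (frechet_derivative h (at x) V *v Y) = Y \<bullet> (frechet_derivative h (at x) V *v X)"
proof (rule inner_matrix_symmetric)
  have lin: "linear (transpose :: real^'n^'n \<Rightarrow> _)"
    by (rule linearI) (simp_all add: transpose_def vec_eq_iff)
  note h = smooth_on_has_derivative[OF smooth_h assms]
  have "((\<lambda>y. transpose (h y)) has_derivative (\<lambda>v. transpose (frechet_derivative h (at x) v))) (at x)"
    by (rule bounded_linear.has_derivative[OF _ h]) (rule lin[unfolded linear_conv_bounded_linear])
  then have "(h has_derivative (\<lambda>v. transpose (frechet_derivative h (at x) v))) (at x)"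
    by (rule has_derivative_transform_within_open[OF _ open_U assms]) (rule sym)
  with h have "frechet_derivative h (at x) = (\<lambda>v. transpose (frechet_derivative h (at x) v))"
    by (rule has_derivative_unique)
  then show "transpose (frechet_derivative h (at x) V) = frechet_derivative h (at x) V"
    by metis
qed

text \<open>Metric compatibility of the Levi-Civita connection. Lowering both Christoffel terms
  gives six derivatives of h; four cancel in pairs and the other two agree by symmetry.\<close>

lemma christoffel_form_compatible:
  assumes "x \<in> U"
  shows "Y \<bullet> (frechet_derivative h (at x) V *v Z) =
    christoffel_form h x V Y \<bullet> (h x *v Z) + Y \<bullet> (h x *v christoffel_form h x V Z)"
  unfolding h_commute[OF assms, of "christoffel_form h x V Y"]
    christoffel_form_lowered[OF h_differentiable[OF assms] h_invertible[OF assms]]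
  using frechet_derivative_h_commute[OF assms, of Y V Z] frechet_derivative_h_commute[OF assms, of Y Z V]
    frechet_derivative_h_commute[OF assms, of V Y Z]
  by (simp add: field_simps)

text \<open>The connection is torsion-free: the lowered formula is symmetric in V and W, and
  \<open>h x\<close> is invertible.\<close>

lemma christoffel_form_commute:
  assumes "x \<in> U"
  shows "christoffel_form h x V W = christoffel_form h x W V"
proof -
  have "Z \<bullet> (h x *v christoffel_form h x V W) = Z \<bullet> (h x *v christoffel_form h x W V)" for Z
    unfolding christoffel_form_lowered[OF h_differentiable[OF assms] h_invertible[OF assms]]
    using frechet_derivative_h_commute[OF assms, of V Z W] by (simp add: field_simps)
  then have "h x *v christoffel_form h x V W = h x *v christoffel_form h x W V"
    using vector_eq_ldot by blast
  then show ?thesis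
    by (metis matrix_inv_vector(2)[OF h_invertible[OF assms]])
qed

lemma christoffel_differentiable:
  assumes "x \<in> U"
  shows "(\<lambda>y. christoffel h y k i j) differentiable (at x)"
proof -
  have "(\<lambda>y. partial_deriv a (\<lambda>z. h z $ b $ c) y) differentiable (at x)" for a b c
  proof (rule differentiable_transform_open[OF open_U assms])
    show "frechet_derivative h (at y) (axis a 1) $ b $ c = partial_deriv a (\<lambda>z. h z $ b $ c) y"
      if "y \<in> U" for y
      using partial_deriv_component[OF h_differentiable[OF that]] by simp
    show "(\<lambda>y. frechet_derivative h (at y) (axis a 1) $ b $ c) differentiable (at x)"
      by (intro differentiable_vec_component smooth_on_differentiable[OF _ assms]
          smooth_on_frechet_derivative smooth_h)
  qed
  then show ?thesis
    unfolding christoffel_def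
    by (intro ballI differentiable_divide differentiable_sum differentiable_mult differentiable_diff
        differentiable_add differentiable_matrix_inv h_differentiable h_invertible assms differentiable_const)
      auto
qed

text \<open>Leibniz rule for the covariant derivative along a curve; metric compatibility absorbs
  the derivative of h.\<close>

lemma has_real_derivative_inner_metric:
  assumes x: "(x has_vector_derivative v) (at t)" "x t \<in> U"
    and "(Y has_vector_derivative Y') (at t)" "(Z has_vector_derivative Z') (at t)"
  shows "((\<lambda>s. Y s \<bullet> (h (x s) *v Z s)) has_real_derivative
    ((Y' + christoffel_form h (x t) v (Y t)) \<bullet> (h (x t) *v Z t) +
     Y t \<bullet> (h (x t) *v (Z' + christoffel_form h (x t) v (Z t))))) (at t)"
  using has_real_derivative_metric_product[OF x(1) h_differentiable[OF x(2)] assms(3,4)]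
  by (simp add: christoffel_form_compatible[OF x(2)] inner_add_left inner_add_right
      matrix_vector_right_distrib add_ac)

text \<open>Lowering an index commutes with covariant differentiation. Metric compatibility gives
  this with \<Gamma>(v, W), whereas the lifts use \<Gamma>(W, v), so torsion-freeness enters as
  well.\<close>

lemma covariant_derivative_flat:
  assumes x: "(x has_vector_derivative v) (at t)" "x t \<in> U"
    and "(Y has_vector_derivative Y') (at t)"
    and "((\<lambda>s. h (x s) *v Y s) has_vector_derivative p') (at t)"
  shows "p' \<bullet> W - (h (x t) *v Y t) \<bullet> christoffel_form h (x t) W v =
    (h (x t) *v (Y' + christoffel_form h (x t) v (Y t))) \<bullet> W"
proof -
  have "p' = h (x t) *v Y' + frechet_derivative h (at (x t)) v *v Y t"
    using has_vector_derivative_matrix_vector[OF x(1) h_differentiable[OF x(2)] assms(3)] assms(4)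
    by (rule vector_derivative_unique_at[rotated])
  moreover have "W \<bullet> (frechet_derivative h (at (x t)) v *v Y t) = christoffel_form h (x t) v W \<bullet> (h (x t) *v Y t)
      + W \<bullet> (h (x t) *v christoffel_form h (x t) v (Y t))"
    by (rule christoffel_form_compatible[OF x(2)])
  ultimately show ?thesis
    by (simp add: christoffel_form_commute[OF x(2), of W] inner_add_left inner_add_right
      matrix_vector_right_distrib inner_commute)
qed

lemma cometric_flat:
  "x \<in> U \<Longrightarrow> cometric h x (h x *v X) (h x *v Y) = X \<bullet> (h x *v Y)"
  by (simp add: cometric_def sharp_def matrix_inv_vector[OF h_invertible])

end

section \<open>Consequences of \<nabla>J = 0 and of the isometry property of J\<close>

locale kaehler_chart = metric_chart U h for U :: "(real^'n::finite) set" and h +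
  fixes J :: "real^'n \<Rightarrow> real^'n^'n"
  assumes smooth_J: "smooth_on J U"
    and J_squared: "\<And>x. x \<in> U \<Longrightarrow> J x ** J x = - mat 1"
    and J_isometry: "\<And>x X Y. x \<in> U \<Longrightarrow> (J x *v X) \<bullet> (h x *v (J x *v Y)) = X \<bullet> (h x *v Y)"
    and J_parallel: "\<And>x k a b. x \<in> U \<Longrightarrow> covariant_deriv_endo h J x k a b = 0"
begin

lemma J_differentiable: "x \<in> U \<Longrightarrow> J differentiable (at x)"
  using smooth_J by (rule smooth_on_differentiable)

text \<open>Isometry for the pair X, JY together with \<open>J x ** J x = - mat 1\<close> moves J to
  the other argument with a sign.\<close>

lemma J_skew:
  assumes "x \<in> U"
  shows "X \<bullet> (h x *v (J x *v Y)) = - (Y \<bullet> (h x *v (J x *v X)))"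
proof -
  have "J x *v (J x *v Y) = - Y"
    by (simp add: matrix_vector_mul_assoc J_squared[OF assms] 
        bounded_bilinear.minus_left[OF bounded_bilinear_matrix_vector_mult])
  then have "X \<bullet> (h x *v (J x *v Y)) = - ((J x *v X) \<bullet> (h x *v Y))"
    using J_isometry[OF assms, of X "J x *v Y"]
    by (simp add: vec.neg)
  then show ?thesis
    by (simp add: h_commute[OF assms])
qed

lemma J_self: "x \<in> U \<Longrightarrow> X \<bullet> (h x *v (J x *v X)) = 0"
  using J_skew[of x X X] by simp

text \<open>This is \<nabla>J = 0 contracted with V, W and an arbitrary test covector X. Facts 1 and
  2 bring J\<Gamma>(V, W) and \<Gamma>(V, JW) to the sums in
  \<open>covariant_deriv_endo\<close>.\<close>

lemma frechet_derivative_J: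
  assumes "x \<in> U"
  shows "frechet_derivative J (at x) V *v W =
    J x *v christoffel_form h x V W - christoffel_form h x V (J x *v W)"
proof -
  have "X \<bullet> (frechet_derivative J (at x) V *v W) =
    X \<bullet> (J x *v christoffel_form h x V W) - X \<bullet> christoffel_form h x V (J x *v W)" for X
  proof -
    let ?G = "christoffel h x"
    have 1: "X \<bullet> (J x *v christoffel_form h x V W) =
      (\<Sum>k\<in>UNIV. \<Sum>a\<in>UNIV. \<Sum>b\<in>UNIV. V $ k * X $ a * W $ b * (\<Sum>l\<in>UNIV. ?G l k b * J x $ a $ l))"
    proof -
      have "(\<Sum>l\<in>UNIV. \<Sum>b\<in>UNIV. (X v* J x) $ l * ?G l k b * W $ b) =
        (\<Sum>a\<in>UNIV. \<Sum>b\<in>UNIV. X $ a * W $ b * (\<Sum>l\<in>UNIV. ?G l k b * J x $ a $ l))" for k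
      proof -
        let ?f = "\<lambda>a b l. X $ a * W $ b * (?G l k b * J x $ a $ l)"
        have "(\<Sum>l\<in>UNIV. \<Sum>b\<in>UNIV. (X v* J x) $ l * ?G l k b * W $ b) =
            (\<Sum>l\<in>UNIV. \<Sum>b\<in>UNIV. \<Sum>a\<in>UNIV. ?f a b l)"
          by (simp add: vector_matrix_mult_def sum_distrib_left sum_distrib_right mult_ac)
        also have "\<dots> = (\<Sum>b\<in>UNIV. \<Sum>l\<in>UNIV. \<Sum>a\<in>UNIV. ?f a b l)"
          by (rule sum.swap)
        also have "\<dots> = (\<Sum>b\<in>UNIV. \<Sum>a\<in>UNIV. \<Sum>l\<in>UNIV. ?f a b l)"
          by (intro sum.cong refl sum.swap)
        also have "\<dots> = (\<Sum>a\<in>UNIV. \<Sum>b\<in>UNIV. \<Sum>l\<in>UNIV. ?f a b l)"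
          by (rule sum.swap)
        finally show ?thesis by (simp add: sum_distrib_left)
      qed
      then show ?thesis
        unfolding dot_lmul_matrix[symmetric] christoffel_form_component_sum
        by (simp add: sum_distrib_left mult_ac)
    qed
    have 2: "X \<bullet> christoffel_form h x V (J x *v W) =
      (\<Sum>k\<in>UNIV. \<Sum>a\<in>UNIV. \<Sum>b\<in>UNIV. V $ k * X $ a * W $ b * (\<Sum>l\<in>UNIV. ?G a k l * J x $ l $ b))"
    proof -
      have "(\<Sum>a\<in>UNIV. \<Sum>l\<in>UNIV. X $ a * ?G a k l * (J x *v W) $ l) =
        (\<Sum>a\<in>UNIV. \<Sum>b\<in>UNIV. X $ a * W $ b * (\<Sum>l\<in>UNIV. ?G a k l * J x $ l $ b))" for k
      proof -
        let ?f = "\<lambda>a b l. X $ a * W $ b * (?G a k l * J x $ l $ b)"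
        have "(\<Sum>a\<in>UNIV. \<Sum>l\<in>UNIV. X $ a * ?G a k l * (J x *v W) $ l) =
            (\<Sum>a\<in>UNIV. \<Sum>l\<in>UNIV. \<Sum>b\<in>UNIV. ?f a b l)"
          by (simp add: matrix_vector_mult_def sum_distrib_left sum_distrib_right mult_ac)
        also have "\<dots> = (\<Sum>a\<in>UNIV. \<Sum>b\<in>UNIV. \<Sum>l\<in>UNIV. ?f a b l)"
          by (intro sum.cong refl sum.swap)
        finally show ?thesis by (simp add: sum_distrib_left)
      qed
      then show ?thesis
        unfolding christoffel_form_component_sum
        by (simp add: sum_distrib_left mult_ac)
    qed
    have "partial_deriv k (\<lambda>y. J y $ a $ b) x =
      (\<Sum>l\<in>UNIV. ?G l k b * J x $ a $ l) - (\<Sum>l\<in>UNIV. ?G a k l * J x $ l $ b)" for k a b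
      using J_parallel[OF assms, of k a b] by (simp add: covariant_deriv_endo_def)
    then show ?thesis
      unfolding inner_frechet_derivative[OF J_differentiable[OF assms]] 1 2
      by (simp only: right_diff_distrib sum_subtractf)
  qed
  then show ?thesis
    unfolding inner_diff_right[symmetric] using vector_eq_ldot by blast
qed

text \<open>J commutes with covariant differentiation along a curve. The value of D is used only
  through this identity, so it stays existential.\<close>

lemma has_vector_derivative_J:
  assumes x: "(x has_vector_derivative v) (at t)" "x t \<in> U"
    and "(Y has_vector_derivative Y') (at t)"
  obtains D where "((\<lambda>s. J (x s) *v Y s) has_vector_derivative D) (at t)"
    and "D + christoffel_form h (x t) v (J (x t) *v Y t) = J (x t) *v (Y' + christoffel_form h (x t) v (Y t))"
  by (rule that[OF has_vector_derivative_matrix_vector[OF x(1) J_differentiable[OF x(2)] assms(3)]])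
    (simp add: frechet_derivative_J[OF x(2)] matrix_vector_right_distrib)

end

section \<open>The deformed Sasaki metric in a chart\<close>

lemma join_parts [simp]: "join (base_part z) (fibre_part z) = z"
  by (simp add: join_def base_part_def fibre_part_def vec_eq_iff split: sum.split)

lemma linear_fibre_part: "linear fibre_part"
  by (rule linearI) (simp_all add: fibre_part_def vec_eq_iff)

lemma join_add: "join (x + x') (p + p') = join x p + join x' p'"
  by (simp add: join_def vec_eq_iff split: sum.split)

lemma join_scaleR: "join (c *\<^sub>R x) (c *\<^sub>R p) = c *\<^sub>R join x p"
  by (simp add: join_def vec_eq_iff split: sum.split)

lemma join_split: "join x p = join x 0 + join 0 p"
  using join_add[of x 0 0 p] by simp

lemma join_eq_0_iff: "join x p = 0 \<longleftrightarrow> x = 0 \<and> p = 0"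
proof
  assume *: "join x p = 0"
  have "base_part (join x p) = 0" "fibre_part (join x p) = 0"
    unfolding * by (rule linear_0[OF linear_base_part], rule linear_0[OF linear_fibre_part])
  then show "x = 0 \<and> p = 0" by simp
qed (simp add: join_def vec_eq_iff split: sum.split)

lemma bounded_linear_join_left: "bounded_linear (\<lambda>x. join x 0)"
  unfolding linear_conv_bounded_linear[symmetric]
  by (rule linearI) (simp_all add: join_def vec_eq_iff split: sum.split)

lemma bounded_linear_join_right: "bounded_linear (\<lambda>p. join 0 p)"
  unfolding linear_conv_bounded_linear[symmetric]
  by (rule linearI) (simp_all add: join_def vec_eq_iff split: sum.split)

lemma has_vector_derivative_join:
  assumes "(x has_vector_derivative x') F" "(p has_vector_derivative p') F"
  shows "((\<lambda>t. join (x t) (p t)) has_vector_derivative join x' p') F"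
proof -
  have "((\<lambda>t. join (x t) 0 + join 0 (p t)) has_vector_derivative (join x' 0 + join 0 p')) F"
    by (intro has_vector_derivative_add bounded_linear.has_vector_derivative[OF bounded_linear_join_left]
        bounded_linear.has_vector_derivative[OF bounded_linear_join_right] assms)
  then show ?thesis
    by (simp add: join_split[symmetric])
qed

lemma transpose_eqI:
  fixes M :: "real^'n^'n"
  assumes "\<And>X Y. X \<bullet> (M *v Y) = Y \<bullet> (M *v X)"
  shows "transpose M = M"
proof -
  have "X \<bullet> (transpose M *v Y) = X \<bullet> (M *v Y)" for X Y
    unfolding transpose_matrix_vector inner_commute[of X "Y v* M"] dot_lmul_matrix
    by (rule assms)
  then have "transpose M *v Y = M *v Y" for Y
    using vector_eq_ldot by blast
  then show ?thesis
    unfolding matrix_eq by blast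
qed

text \<open>The lowered formula for \<Gamma>(v, v) gives \<open>v \<bullet> (D\<^sub>v M) W - (v
  \<bullet> (D\<^sub>W M) v) / 2\<close>. Its first term is what the product rule produces from M.
  The test field W may vary with time, which contributes W'.\<close>

lemma euler_lagrange:
  fixes M :: "real^'n::finite \<Rightarrow> real^'n^'n"
  assumes z: "(z has_vector_derivative v t) (at t)" "(v has_vector_derivative a) (at t)"
    and W: "(W has_vector_derivative W') (at t)"
    and M: "M differentiable (at (z t))" "invertible (M (z t))" "transpose (M (z t)) = M (z t)"
  shows "((\<lambda>s. v s \<bullet> (M (z s) *v W s)) has_real_derivative
    (W t \<bullet> (M (z t) *v (a + christoffel_form M (z t) (v t) (v t))) + v t \<bullet> (M (z t) *v W')
      + v t \<bullet> (frechet_derivative M (at (z t)) (W t) *v v t) / 2)) (at t)"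
  by (rule DERIV_cong[OF has_real_derivative_metric_product[OF z(1) M(1) z(2) W]])
    (simp add: christoffel_form_lowered[OF M(1,2)] matrix_vector_right_distrib inner_add_right
      inner_matrix_symmetric[OF M(3), of a] field_simps)

lemma directional_derivative_quadratic:
  fixes M :: "real^'n::finite \<Rightarrow> real^'n^'n"
  assumes "M differentiable (at z)"
  shows "((\<lambda>s. V \<bullet> (M (z + s *\<^sub>R W) *v V)) has_real_derivative
    V \<bullet> (frechet_derivative M (at z) W *v V)) (at 0)"
proof -
  have "((\<lambda>s. z + s *\<^sub>R W) has_vector_derivative W) (at 0)"
    by (auto intro!: derivative_eq_intros)
  from has_real_derivative_metric_product[OF this, of M "\<lambda>_. V" 0 "\<lambda>_. V" 0] assms
  show ?thesis by simp
qed

text \<open>With all three arguments equal to v the lowered formula leaves half the derivative of M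
  along v. In particular a geodesic conserves its energy.\<close>

lemma kinetic_energy_derivative:
  fixes M :: "real^'n::finite \<Rightarrow> real^'n^'n"
  assumes z: "(z has_vector_derivative v t) (at t)" "(v has_vector_derivative a) (at t)"
    and M: "M differentiable (at (z t))" "invertible (M (z t))" "transpose (M (z t)) = M (z t)"
  shows "((\<lambda>s. v s \<bullet> (M (z s) *v v s)) has_real_derivative
    2 * (v t \<bullet> (M (z t) *v (a + christoffel_form M (z t) (v t) (v t))))) (at t)"
  by (rule DERIV_cong[OF has_real_derivative_metric_product[OF z(1) M(1) z(2) z(2)]])
    (simp add: christoffel_form_lowered[OF M(1,2)] matrix_vector_right_distrib inner_add_right
      inner_matrix_symmetric[OF M(3), of a] field_simps)

context kaehler_chart
begin

text \<open>One chart is fixed here, so the chart index of \<open>berger_sasaki_metric\<close> is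
  drawn from the one-point type \<open>unit\<close>.\<close>

abbreviation "bs \<delta> \<equiv> berger_sasaki_metric (\<lambda>_::unit. J) (\<lambda>_. h) \<delta> ()"

lemma bs_form: "W \<bullet> (bs \<delta> z *v Z) = berger_sasaki_form h J \<delta> (base_part z) (fibre_part z) W Z"
  using berger_sasaki_metric_form[of W "\<lambda>_::unit. J" "\<lambda>_. h" \<delta> "()" "base_part z" "fibre_part z" Z]
  by simp

lemma cometric_commute: "x \<in> U \<Longrightarrow> cometric h x \<alpha> \<beta> = cometric h x \<beta> \<alpha>"
  unfolding cometric_def by (rule h_commute)

lemma cometric_nonneg: "x \<in> U \<Longrightarrow> cometric h x \<alpha> \<alpha> \<ge> 0"
  unfolding cometric_def by (rule h_nonneg)

lemma transpose_bs:
  assumes "base_part z \<in> U"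
  shows "transpose (bs \<delta> z) = bs \<delta> z"
proof (rule transpose_eqI)
  fix X Y
  show "X \<bullet> (bs \<delta> z *v Y) = Y \<bullet> (bs \<delta> z *v X)"
    unfolding bs_form berger_sasaki_form_def Let_def h_commute[OF assms, of "base_part X" "base_part Y"]
      cometric_commute[OF assms, of "vertical_component h (base_part z) (fibre_part z) X"
        "vertical_component h (base_part z) (fibre_part z) Y"]
    by (simp add: mult_ac)
qed

text \<open>All three terms of the form are nonnegative. A nonzero W has a nonzero base part or else
  a nonzero vertical component, and positivity of h applies to the first or to the sharp of the
  second.\<close>

lemma bs_pos:
  assumes "base_part z \<in> U" "W \<noteq> 0"
  shows "W \<bullet> (bs \<delta> z *v W) > 0"
proof -
  let ?c = "cometric h (base_part z)"
  let ?\<omega> = "vertical_component h (base_part z) (fibre_part z) W"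
  have nonneg: "?c ?\<omega> ?\<omega> \<ge> 0" "\<delta>\<^sup>2 * ?c ?\<omega> \<beta> * ?c ?\<omega> \<beta> \<ge> 0" for \<beta>
    using cometric_nonneg[OF assms(1)] by (simp_all add: mult.assoc)
  show ?thesis
  proof (cases "base_part W = 0")
    case False
    from pos[OF assms(1) this] nonneg show ?thesis
      unfolding bs_form berger_sasaki_form_def Let_def by (simp add: add_pos_nonneg)
  next
    case True
    have "?\<omega> \<noteq> 0"
    proof
      assume "?\<omega> = 0"
      \<comment> \<open>Without base part there is no Christoffel term, so testing on
        \<open>fibre_part W\<close> yields its squared Euclidean length.\<close>
      with True vertical_component_inner[of h "base_part z" "fibre_part z" W "fibre_part W"]
      have "fibre_part W = 0"
        by (simp add: bilinear_rzero[OF bilinear_christoffel_form])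
      with True join_parts[of W] have "W = 0"
        by (metis join_eq_0_iff)
      with assms show False by simp
    qed
    then have "sharp h (base_part z) ?\<omega> \<noteq> 0"
      unfolding sharp_def using matrix_inv_vector(1)[OF h_invertible[OF assms(1)], of ?\<omega>] by auto
    from pos[OF assms(1) this] nonneg(2) True show ?thesis
      unfolding bs_form berger_sasaki_form_def Let_def by (simp add: add_pos_nonneg cometric_def[symmetric])
  qed
qed

lemma invertible_bs: "base_part z \<in> U \<Longrightarrow> invertible (bs \<delta> z)"
  using bs_pos by (rule positive_definite_imp_invertible)

text \<open>The Christoffel correction is linear in the covector; the zero fibre part of
  \<open>join (base_part W) 0\<close> isolates this correction.\<close>

lemma vertical_component_linear_fibre:
  "vertical_component h x (p + s *\<^sub>R \<theta>) W =
    vertical_component h x p W + s *\<^sub>R vertical_component h x \<theta> (join (base_part W) 0)"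
proof -
  have "vertical_component h x (p + s *\<^sub>R \<theta>) W \<bullet> Y =
    (vertical_component h x p W + s *\<^sub>R vertical_component h x \<theta> (join (base_part W) 0)) \<bullet> Y" for Y
    by (simp add: vertical_component_inner inner_add_left right_diff_distrib)
  then show ?thesis
    using vector_eq_rdot by blast
qed

text \<open>The entries are polynomials in the fibre coordinates and the entries of h, its inverse,
  J and the Christoffel symbols.\<close>

lemma bs_differentiable:
  assumes "base_part z \<in> U"
  shows "bs \<delta> differentiable (at z)"
proof -
  have base: "base_part differentiable (at z)" and fibre: "fibre_part differentiable (at z)"
    by (simp_all add: linear_imp_differentiable linear_base_part linear_fibre_part)
  have comp: "(\<lambda>y. f (base_part y)) differentiable (at z)"
    if "f differentiable (at (base_part z))" for f :: "real^'n \<Rightarrow> real"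
    using that base by (rule differentiable_compose[of f base_part])
  have h: "(\<lambda>y. h (base_part y) $ k $ l) differentiable (at z)" for k l
    by (rule comp[of "\<lambda>x. h x $ k $ l"])
      (rule differentiable_vec_component[OF differentiable_vec_component[OF h_differentiable[OF assms]]])
  have J: "(\<lambda>y. J (base_part y) $ k $ l) differentiable (at z)" for k l
    by (rule comp[of "\<lambda>x. J x $ k $ l"])
      (rule differentiable_vec_component[OF differentiable_vec_component[OF J_differentiable[OF assms]]])
  have inv: "(\<lambda>y. matrix_inv (h (base_part y)) $ k $ l) differentiable (at z)" for k l
    by (rule comp[of "\<lambda>x. matrix_inv (h x) $ k $ l"])
      (rule differentiable_matrix_inv[OF h_differentiable[OF assms] h_invertible[OF assms]])
  have \<Gamma>: "(\<lambda>y. christoffel h (base_part y) k a b) differentiable (at z)" for k a b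
    by (rule comp[of "\<lambda>x. christoffel h x k a b"]) (rule christoffel_differentiable[OF assms])
  have p: "(\<lambda>y. fibre_part y $ k) differentiable (at z)" for k
    by (rule differentiable_vec_component[OF fibre])
  have c: "(\<lambda>y. cometric h (base_part y) (\<alpha> y) (\<beta> y)) differentiable (at z)"
    if "\<And>k. (\<lambda>y. \<alpha> y $ k) differentiable (at z)" "\<And>k. (\<lambda>y. \<beta> y $ k) differentiable (at z)" for \<alpha> \<beta>
    unfolding cometric_def sharp_def inner_vec_def matrix_vector_mult_def vec_lambda_beta inner_real_def
    by (intro ballI differentiable_sum differentiable_mult h inv that) auto
  have vc: "(\<lambda>y. vertical_component h (base_part y) (fibre_part y) W $ k) differentiable (at z)" for W k
    unfolding vertical_component_def horizontal_lift_def fibre_part_def[of "W - _"] join_def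
      vec_lambda_beta vector_minus_component sum.case
    by (intro ballI differentiable_sum differentiable_mult differentiable_diff differentiable_const p \<Gamma>) auto
  have pJ: "(\<lambda>y. (fibre_part y v* J (base_part y)) $ k) differentiable (at z)" for k
    unfolding vector_matrix_mult_def vec_lambda_beta
    by (intro ballI differentiable_sum differentiable_mult p J) auto
  have h': "(\<lambda>y. X \<bullet> (h (base_part y) *v Y)) differentiable (at z)" for X Y
    unfolding inner_vec_def matrix_vector_mult_def vec_lambda_beta inner_real_def
    by (intro ballI differentiable_sum differentiable_mult h differentiable_const) auto
  show ?thesis
    unfolding berger_sasaki_metric_def berger_sasaki_form_def Let_def
    by (intro differentiable_vec_lambda differentiable_add differentiable_mult differentiable_const h' c vc pJ)
qed

text \<open>Along \<open>p + s *\<^sub>R \<theta>\<close> the base point is fixed, so the form is a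
  polynomial in s. Two ingredients move: the vertical component \<alpha>, by
  \<open>s *\<^sub>R \<beta>\<close>, and the covector pJ, by
  \<open>s *\<^sub>R \<theta>J\<close>.\<close>

lemma fibre_derivative_bs:
  fixes x p \<theta> :: "real^'n" and V :: "real^('n + 'n)"
  assumes "x \<in> U"
  defines "\<alpha> \<equiv> vertical_component h x p V" and "\<beta> \<equiv> vertical_component h x \<theta> (join (base_part V) 0)"
  shows "V \<bullet> (frechet_derivative (bs \<delta>) (at (join x p)) (join 0 \<theta>) *v V) / 2 =
    cometric h x \<alpha> \<beta> + \<delta>\<^sup>2 * cometric h x \<alpha> (p v* J x) *
      (cometric h x \<beta> (p v* J x) + cometric h x \<alpha> (\<theta> v* J x))"
proof -
  let ?c = "cometric h x"
  have form: "V \<bullet> (bs \<delta> (join x p + s *\<^sub>R join 0 \<theta>) *v V) =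
    base_part V \<bullet> (h x *v base_part V) + (?c \<alpha> \<alpha> + s * 2 * ?c \<alpha> \<beta> + s * s * ?c \<beta> \<beta>)
    + \<delta>\<^sup>2 * (?c \<alpha> (p v* J x) + s * ?c \<beta> (p v* J x) + s * ?c \<alpha> (\<theta> v* J x) + s * s * ?c \<beta> (\<theta> v* J x))\<^sup>2" for s
  proof -
    have "join x p + s *\<^sub>R join 0 \<theta> = join x (p + s *\<^sub>R \<theta>)"
      using join_add[of x 0 p "s *\<^sub>R \<theta>"] join_scaleR[of s 0 \<theta>] by simp
    then show ?thesis
      unfolding bs_form
      by (simp add: berger_sasaki_form_def Let_def vertical_component_linear_fibre \<alpha>_def[symmetric]
          \<beta>_def[symmetric] bilinear_ladd[OF bilinear_cometric] bilinear_radd[OF bilinear_cometric]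
          bilinear_lmul[OF bilinear_cometric] bilinear_rmul[OF bilinear_cometric]
          cometric_commute[OF assms(1), of \<beta> \<alpha>] vector_matrix_left_distrib scaleR_vector_matrix_assoc
          power2_eq_square algebra_simps)
  qed
  have "((\<lambda>s. V \<bullet> (bs \<delta> (join x p + s *\<^sub>R join 0 \<theta>) *v V)) has_real_derivative
    2 * (?c \<alpha> \<beta> + \<delta>\<^sup>2 * ?c \<alpha> (p v* J x) * (?c \<beta> (p v* J x) + ?c \<alpha> (\<theta> v* J x)))) (at 0)"
    unfolding form by (auto intro!: derivative_eq_intros simp: algebra_simps)
  moreover have "((\<lambda>s. V \<bullet> (bs \<delta> (join x p + s *\<^sub>R join 0 \<theta>) *v V)) has_real_derivative
    V \<bullet> (frechet_derivative (bs \<delta>) (at (join x p)) (join 0 \<theta>) *v V)) (at 0)"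
    using assms(1) by (intro directional_derivative_quadratic bs_differentiable) simp
  ultimately show ?thesis
    using DERIV_unique by fastforce
qed

text \<open>Skewness of J, read through the identification of vectors with covectors.\<close>

lemma flat_J:
  assumes "x \<in> U"
  shows "(h x *v Z) v* J x = - (h x *v (J x *v Z))"
proof -
  have "((h x *v Z) v* J x) \<bullet> Y = (- (h x *v (J x *v Z))) \<bullet> Y" for Y
    using J_skew[OF assms, of Z Y] h_commute[OF assms, of Z "J x *v Y"]
    unfolding dot_lmul_matrix inner_minus_left inner_commute[of "h x *v Z"]
      inner_commute[of "h x *v (J x *v Z)"]
    by simp
  then show ?thesis
    using vector_eq_rdot by blast
qed

end

section \<open>The lifted curve in a chart\<close>

lemma smooth_on_vector_derivative:
  assumes "open T" "smooth_on x T"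
  shows "smooth_on (\<lambda>t. vector_derivative x (at t)) T"
proof -
  have "frechet_derivative x (at t) 1 = vector_derivative x (at t)" if "t \<in> T" for t
    using frechet_derivative_eq_vector_derivative[OF smooth_on_differentiable[OF assms(2) that]] by simp
  moreover have "Ck_on k (\<lambda>t. frechet_derivative x (at t) 1) T" for k
    using smooth_on_frechet_derivative[OF assms(2)] by (simp add: smooth_on_def)
  ultimately show ?thesis
    unfolding smooth_on_def
    using Ck_on_cong[OF assms(1), of "\<lambda>t. frechet_derivative x (at t) 1" "\<lambda>t. vector_derivative x (at t)"]
    by simp
qed

lemma smooth_on_has_vector_derivative:
  "smooth_on x T \<Longrightarrow> t \<in> T \<Longrightarrow> (x has_vector_derivative vector_derivative x (at t)) (at t)"
  using smooth_on_differentiable vector_derivative_works by blast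

lemma smooth_on_flat:
  fixes h :: "'b::euclidean_space \<Rightarrow> real^'n^'m"
  assumes "open T" "open U" "x ` T \<subseteq> U" "smooth_on h U" "smooth_on x T" "smooth_on v T"
  shows "smooth_on (\<lambda>t. h (x t) *v v t) T"
  unfolding smooth_on_def
proof
  fix k
  show "Ck_on k (\<lambda>t. h (x t) *v v t) T"
    using assms unfolding smooth_on_def
    by (intro Ck_on_bounded_bilinear[OF _ bounded_bilinear_matrix_vector_mult]
        Ck_on_compose[of T U x k h]) auto
qed

lemma smooth_on_join:
  assumes "open T" "smooth_on x T" "smooth_on p T"
  shows "smooth_on (\<lambda>t. join (x t) (p t)) T"
proof -
  have "Ck_on k (\<lambda>t. join (x t) 0 + join 0 (p t)) T" for k
    using assms unfolding smooth_on_def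
    by (intro Ck_on_add Ck_on_bounded_linear[OF _ bounded_linear_join_left]
        Ck_on_bounded_linear[OF _ bounded_linear_join_right]) auto
  then show ?thesis
    by (simp add: smooth_on_def join_split[symmetric])
qed

text \<open>The covariant acceleration of a curve already written in coordinates; it serves for
  \<gamma> in a chart of the base and for the lift in a chart of the cotangent bundle.\<close>

definition acceleration ::
  "(real^'n::finite \<Rightarrow> real^'n^'n) \<Rightarrow> (real \<Rightarrow> real^'n) \<Rightarrow> real \<Rightarrow> real^'n" where
  "acceleration h x t = vector_derivative (\<lambda>s. vector_derivative x (at s)) (at t)
     + christoffel_form h (x t) (vector_derivative x (at t)) (vector_derivative x (at t))"

lemma (in metric_chart) acceleration_differentiable:
  assumes "open T" "smooth_on x T" "x ` T \<subseteq> U" "t \<in> T"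
  shows "acceleration h x differentiable (at t)"
proof -
  have T: "x t \<in> U" using assms by auto
  let ?v = "\<lambda>s. vector_derivative x (at s)"
  have v: "smooth_on ?v T"
    using assms by (intro smooth_on_vector_derivative)
  have \<Gamma>: "(\<lambda>s. christoffel h (x s) k a b) differentiable (at t)" for k a b
    by (rule differentiable_compose[of "\<lambda>y. christoffel h y k a b"])
      (rule christoffel_differentiable[OF T], rule smooth_on_differentiable[OF assms(2,4)])
  have vk: "(\<lambda>s. ?v s $ k) differentiable (at t)" for k
    by (rule differentiable_vec_component[OF smooth_on_differentiable[OF v assms(4)]])
  show ?thesis
    unfolding acceleration_def christoffel_form_def
    by (intro differentiable_add smooth_on_differentiable[OF smooth_on_vector_derivative[OF assms(1) v] assms(4)]
        differentiable_vec_lambda ballI differentiable_sum differentiable_mult vk \<Gamma>) auto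
qed

lemma zero_derivative_at_zero_min:
  fixes f :: "real \<Rightarrow> real"
  assumes "(f has_real_derivative D) (at 0)" "\<forall>\<^sub>F s in nhds 0. f s \<ge> 0" "f 0 = 0"
  shows "D = 0"
proof -
  from assms(2) obtain d where "d > 0" "\<And>s. \<bar>s\<bar> < d \<Longrightarrow> f s \<ge> 0"
    unfolding eventually_nhds_metric by (auto simp: dist_real_def)
  then show ?thesis
    using DERIV_local_min[OF assms(1), of d] assms(3) by auto
qed

context kaehler_chart
begin

text \<open>Along \<open>join x p + s *\<^sub>R W\<close> with V fixed, the full form minus its base
  term is the vertical part: nonnegative while the base point stays in U, and zero at s = 0 because
  V is horizontal there. This minimum forces the two derivatives to agree.\<close>

lemma horizontal_quadratic_derivative:
  assumes "x \<in> U" "vertical_component h x p V = 0"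
  shows "V \<bullet> (frechet_derivative (bs \<delta>) (at (join x p)) W *v V) =
    base_part V \<bullet> (frechet_derivative h (at x) (base_part W) *v base_part V)"
proof -
  let ?z = "\<lambda>s. join x p + s *\<^sub>R W"
  let ?x = "\<lambda>s. x + s *\<^sub>R base_part W"
  let ?f = "\<lambda>s. V \<bullet> (bs \<delta> (?z s) *v V) - base_part V \<bullet> (h (?x s) *v base_part V)"
  have base: "base_part (?z s) = ?x s" for s
    by (simp add: linear_add[OF linear_base_part] linear_scale[OF linear_base_part])
  have "(?f has_real_derivative
      (V \<bullet> (frechet_derivative (bs \<delta>) (at (join x p)) W *v V) -
       base_part V \<bullet> (frechet_derivative h (at x) (base_part W) *v base_part V))) (at 0)"
    using assms(1)
    by (intro DERIV_diff directional_derivative_quadratic bs_differentiable h_differentiable) simp_all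
  moreover have "\<forall>\<^sub>F s in nhds 0. ?f s \<ge> 0"
  proof -
    have "((\<lambda>s. ?x s) \<longlongrightarrow> x + 0 *\<^sub>R base_part W) (nhds 0)"
      by (intro tendsto_intros filterlim_ident)
    then have "\<forall>\<^sub>F s in nhds 0. ?x s \<in> U"
      using assms(1) open_U topological_tendstoD by fastforce
    then show ?thesis
    proof eventually_elim
      case (elim s)
      show ?case
        unfolding bs_form berger_sasaki_form_def Let_def base
        using cometric_nonneg[OF elim] by (simp add: mult.assoc)
    qed
  qed
  moreover have "?f 0 = 0"
    using assms(2) by (simp add: bs_form berger_sasaki_form_def Let_def bilinear_lzero[OF bilinear_cometric])
  ultimately show ?thesis
    using zero_derivative_at_zero_min by fastforce
qed

end

locale kaehler_curve = kaehler_chart U h J for U :: "(real^'n::finite) set" and h J +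
  fixes T :: "real set" and x :: "real \<Rightarrow> real^'n" and \<delta> :: real
  assumes open_T: "open T" and smooth_x: "smooth_on x T" and x_in_U: "x ` T \<subseteq> U"
begin

abbreviation "v t \<equiv> vector_derivative x (at t)"
abbreviation "p t \<equiv> h (x t) *v v t"
text \<open>The plain coordinate derivative of p; its covariant derivative is \<omega>, by
  \<open>vertical_z_velocity\<close>.\<close>

abbreviation "p' t \<equiv> vector_derivative p (at t)"
abbreviation "z t \<equiv> join (x t) (p t)"
abbreviation "acc \<equiv> acceleration h x"
abbreviation "\<omega> t \<equiv> h (x t) *v acc t"
abbreviation "\<nu> t \<equiv> acc t \<bullet> (h (x t) *v (J (x t) *v v t))"

lemma x_mem: "t \<in> T \<Longrightarrow> x t \<in> U"
  using x_in_U by auto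

lemma smooth_v: "smooth_on v T"
  by (rule smooth_on_vector_derivative[OF open_T smooth_x])

lemma smooth_p: "smooth_on p T"
  by (rule smooth_on_flat[OF open_T open_U x_in_U smooth_h smooth_x smooth_v])

lemma smooth_z: "smooth_on z T"
  by (rule smooth_on_join[OF open_T smooth_x smooth_p])

lemma smooth_p': "smooth_on p' T"
  by (rule smooth_on_vector_derivative[OF open_T smooth_p])

lemmas x_deriv = smooth_on_has_vector_derivative[OF smooth_x]
lemmas v_deriv = smooth_on_has_vector_derivative[OF smooth_v]
lemmas p_deriv = smooth_on_has_vector_derivative[OF smooth_p]
lemmas p'_deriv = smooth_on_has_vector_derivative[OF smooth_p']

lemma acc_deriv: "t \<in> T \<Longrightarrow> (acc has_vector_derivative vector_derivative acc (at t)) (at t)"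
  using acceleration_differentiable[OF open_T smooth_x x_in_U] vector_derivative_works by blast

lemma z_velocity: "t \<in> T \<Longrightarrow> vector_derivative z (at t) = join (v t) (p' t)"
  by (rule vector_derivative_at[OF has_vector_derivative_join[OF x_deriv p_deriv]])

text \<open>The vertical part of the velocity of (x, g(Y, \<cdot>)) is a covariant derivative, and
  lowering the index commutes with it. For Y = \<gamma>' the lift gets the vertical part g(a,
  \<cdot>).\<close>

lemma covariant_derivative_vertical_component:
  assumes "t \<in> T" "(Y has_vector_derivative Y') (at t)"
    and "((\<lambda>s. h (x s) *v Y s) has_vector_derivative q) (at t)"
  shows "vertical_component h (x t) (h (x t) *v Y t) (join (v t) q) =
    h (x t) *v (Y' + christoffel_form h (x t) (v t) (Y t))"
proof -
  have "vertical_component h (x t) (h (x t) *v Y t) (join (v t) q) \<bullet> W =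
    (h (x t) *v (Y' + christoffel_form h (x t) (v t) (Y t))) \<bullet> W" for W
    using covariant_derivative_flat[OF x_deriv[OF assms(1)] x_mem[OF assms(1)] assms(2,3)]
    by (simp add: vertical_component_inner)
  then show ?thesis
    using vector_eq_rdot by blast
qed

lemma vertical_z_velocity: "t \<in> T \<Longrightarrow> vertical_component h (x t) (p t) (join (v t) (p' t)) = \<omega> t"
  unfolding acceleration_def by (rule covariant_derivative_vertical_component[OF _ v_deriv p_deriv])

text \<open>
  The metric on vertical lifts of the covectors \<open>g(A, \<cdot>)\<close> and \<open>g(B, \<cdot>)\<close> at \<open>p = g(\<gamma>', \<cdot>)\<close>. Here
  \<open>pJ = - g(J\<gamma>', \<cdot>)\<close>; the sign cancels.
\<close>

definition vertical_pairing :: "real \<Rightarrow> real^'n \<Rightarrow> real^'n \<Rightarrow> real" where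
  "vertical_pairing t A B = A \<bullet> (h (x t) *v B) + \<delta>\<^sup>2 * (A \<bullet> (h (x t) *v (J (x t) *v v t))) * (B \<bullet> (h (x t) *v (J (x t) *v v t)))"

lemma bs_z_velocity:
  assumes "t \<in> T"
  shows "join (v t) (p' t) \<bullet> (bs \<delta> (z t) *v W) =
    v t \<bullet> (h (x t) *v base_part W) +
    (cometric h (x t) (\<omega> t) (vertical_component h (x t) (p t) W)
      + \<delta>\<^sup>2 * cometric h (x t) (\<omega> t) (p t v* J (x t)) * cometric h (x t) (vertical_component h (x t) (p t) W) (p t v* J (x t)))"
  by (simp add: bs_form berger_sasaki_form_def Let_def vertical_z_velocity[OF assms])

lemma cometric_flat_J: "t \<in> T \<Longrightarrow> cometric h (x t) (h (x t) *v A) (p t v* J (x t)) = - (A \<bullet> (h (x t) *v (J (x t) *v v t)))"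
  by (simp add: flat_J x_mem bilinear_rneg[OF bilinear_cometric] cometric_flat)

lemma bs_vertical:
  assumes "t \<in> T"
  shows "join (v t) (p' t) \<bullet> (bs \<delta> (z t) *v join 0 (h (x t) *v Y)) = vertical_pairing t (acc t) Y"
  using assms vertical_component_vertical_lift[of h "x t" "p t" "h (x t) *v Y"]
  by (simp add: bs_z_velocity vertical_lift_def cometric_flat_J cometric_flat x_mem vertical_pairing_def)

abbreviation "z' s \<equiv> join (v s) (p' s)"

lemma z_deriv: "t \<in> T \<Longrightarrow> (z has_vector_derivative z' t) (at t)"
  by (intro has_vector_derivative_join x_deriv p_deriv)

text \<open>\<open>acceleration\<close> differentiates \<open>vector_derivative z\<close>, which is
  known to equal \<open>z'\<close> only on T; openness of T makes the second derivatives
  agree.\<close>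

lemma z'_deriv:
  assumes "t \<in> T"
  obtains a where "(z' has_vector_derivative a) (at t)"
    and "acceleration (bs \<delta>) z t = a + christoffel_form (bs \<delta>) (z t) (z' t) (z' t)"
proof
  show d: "(z' has_vector_derivative join (vector_derivative v (at t)) (vector_derivative p' (at t))) (at t)"
    by (intro has_vector_derivative_join v_deriv p'_deriv assms)
  have "((\<lambda>s. vector_derivative z (at s)) has_vector_derivative
      join (vector_derivative v (at t)) (vector_derivative p' (at t))) (at t)"
    by (rule has_vector_derivative_transform_within_open[OF d open_T assms]) (simp add: z_velocity)
  then show "acceleration (bs \<delta>) z t = join (vector_derivative v (at t)) (vector_derivative p' (at t))
      + christoffel_form (bs \<delta>) (z t) (z' t) (z' t)"
    by (simp add: acceleration_def vector_derivative_at z_velocity assms)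
qed

lemma bs_z:
  assumes "t \<in> T"
  shows "bs \<delta> differentiable (at (z t))" "invertible (bs \<delta> (z t))" "transpose (bs \<delta> (z t)) = bs \<delta> (z t)"
  using x_mem[OF assms] by (auto intro: bs_differentiable invertible_bs transpose_bs)

text \<open>The Euler-Lagrange equation of the lift, tested with the vertical lift of g(Y, \<cdot>).
  A vertical test vector keeps the base point fixed, so only the fibre derivative of the metric
  appears. The last term comes from the dependence of pJ on p.\<close>

lemma vertical_equation:
  assumes t: "t \<in> T" and Y: "(Y has_vector_derivative Y') (at t)"
    and q: "((\<lambda>s. h (x s) *v Y s) has_vector_derivative q) (at t)"
  shows "((\<lambda>s. vertical_pairing s (acc s) (Y s)) has_real_derivative
    (join 0 (h (x t) *v Y t) \<bullet> (bs \<delta> (z t) *v acceleration (bs \<delta>) z t)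
     + vertical_pairing t (acc t) (Y' + christoffel_form h (x t) (v t) (Y t))
     + \<delta>\<^sup>2 * \<nu> t * (acc t \<bullet> (h (x t) *v (J (x t) *v Y t))))) (at t)"
proof -
  let ?W = "\<lambda>s. join 0 (h (x s) *v Y s)"
  let ?DY = "Y' + christoffel_form h (x t) (v t) (Y t)"
  note Ut = x_mem[OF t]
  obtain a where z': "(z' has_vector_derivative a) (at t)"
    and acc_z: "acceleration (bs \<delta>) z t = a + christoffel_form (bs \<delta>) (z t) (z' t) (z' t)"
    by (rule z'_deriv[OF t])
  have W: "(?W has_vector_derivative join 0 q) (at t)"
    by (intro has_vector_derivative_join q has_vector_derivative_const)
  \<comment> \<open>The coordinate derivative q lacks its Christoffel correction;
    \<open>fibre_derivative_bs\<close> supplies it as the change of the vertical component of the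
    velocity when p moves. Together they form g(\<nabla>Y, \<cdot>).\<close>
  have nab: "vertical_component h (x t) (p t) (join 0 q) + vertical_component h (x t) (h (x t) *v Y t) (join (v t) 0) = h (x t) *v ?DY"
  proof -
    have "vertical_component h (x t) (p t) (join 0 q) + vertical_component h (x t) (h (x t) *v Y t) (join (v t) 0)
      = vertical_component h (x t) (h (x t) *v Y t) (join (v t) q)"
      using vertical_component_vertical_lift[of h "x t" "p t" q]
        vertical_component_vertical_lift[of h "x t" "h (x t) *v Y t" q]
        linear_add[OF linear_vertical_component[of h "x t" "h (x t) *v Y t"], of "join (v t) 0" "join 0 q"]
      by (simp add: vertical_lift_def join_split[symmetric])
    then show ?thesis
      by (simp add: covariant_derivative_vertical_component[OF t Y q])
  qed
  have eq: "join 0 (h (x t) *v Y t) \<bullet> (bs \<delta> (z t) *v acceleration (bs \<delta>) z t)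
     + z' t \<bullet> (bs \<delta> (z t) *v join 0 q)
     + z' t \<bullet> (frechet_derivative (bs \<delta>) (at (z t)) (?W t) *v z' t) / 2 =
    join 0 (h (x t) *v Y t) \<bullet> (bs \<delta> (z t) *v acceleration (bs \<delta>) z t)
     + vertical_pairing t (acc t) ?DY + \<delta>\<^sup>2 * \<nu> t * (acc t \<bullet> (h (x t) *v (J (x t) *v Y t)))"
  proof -
    let ?c = "cometric h (x t)" and ?pJ = "p t v* J (x t)"
    let ?a = "vertical_component h (x t) (p t) (join 0 q)"
    let ?b = "vertical_component h (x t) (h (x t) *v Y t) (join (v t) 0)"
    have "z' t \<bullet> (bs \<delta> (z t) *v join 0 q)
     + z' t \<bullet> (frechet_derivative (bs \<delta>) (at (z t)) (?W t) *v z' t) / 2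
     = ?c (\<omega> t) (?a + ?b) + \<delta>\<^sup>2 * ?c (\<omega> t) ?pJ * ?c (?a + ?b) ?pJ
       + \<delta>\<^sup>2 * ?c (\<omega> t) ?pJ * ?c (\<omega> t) ((h (x t) *v Y t) v* J (x t))"
      unfolding bs_z_velocity[OF t] fibre_derivative_bs[OF Ut]
      by (simp add: vertical_z_velocity[OF t] bilinear_ladd[OF bilinear_cometric]
          bilinear_radd[OF bilinear_cometric] algebra_simps)
    \<comment> \<open>Each factor containing J acquires a minus sign; these factors occur in
      pairs.\<close>
    also have "\<dots> = vertical_pairing t (acc t) ?DY + \<delta>\<^sup>2 * \<nu> t * (acc t \<bullet> (h (x t) *v (J (x t) *v Y t)))"
      unfolding nab cometric_flat_J[OF t]
      by (simp add: vertical_pairing_def cometric_flat[OF Ut] flat_J[OF Ut] bilinear_rneg[OF bilinear_cometric])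
    finally show ?thesis by simp
  qed
  have "((\<lambda>s. z' s \<bullet> (bs \<delta> (z s) *v ?W s)) has_real_derivative
    (join 0 (h (x t) *v Y t) \<bullet> (bs \<delta> (z t) *v acceleration (bs \<delta>) z t)
     + vertical_pairing t (acc t) ?DY + \<delta>\<^sup>2 * \<nu> t * (acc t \<bullet> (h (x t) *v (J (x t) *v Y t))))) (at t)"
    using euler_lagrange[OF z_deriv[OF t] z' W bs_z[OF t]] unfolding acc_z[symmetric] eq .
  then show ?thesis
    by (rule has_field_derivative_transform_within_open[OF _ open_T t]) (rule bs_vertical)
qed


section \<open>A geodesic lift forces a geodesic base curve\<close>

lemma flat_deriv:
  assumes "t \<in> T" "(Y has_vector_derivative Y') (at t)"
  obtains q where "((\<lambda>s. h (x s) *v Y s) has_vector_derivative q) (at t)"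
  using has_vector_derivative_matrix_vector[OF x_deriv[OF assms(1)] h_differentiable[OF x_mem[OF assms(1)]] assms(2)]
  by blast

text \<open>The derivative is computed twice, with B = \<nabla>a. The vertical equation for Y = a
  gives the pairing of a with B once, because g(a, Ja) = 0; the Leibniz rule gives it twice. So that
  pairing vanishes.\<close>

lemma vertical_pairing_acc_constant:
  assumes t: "t \<in> T" and geo: "acceleration (bs \<delta>) z t = 0"
  shows "((\<lambda>s. vertical_pairing s (acc s) (acc s)) has_real_derivative 0) (at t)"
proof -
  define B where "B = vector_derivative acc (at t) + christoffel_form h (x t) (v t) (acc t)"
  note Ut = x_mem[OF t]
  obtain q where q: "(\<omega> has_vector_derivative q) (at t)"
    by (rule flat_deriv[OF t acc_deriv[OF t]])
  have 1: "((\<lambda>s. vertical_pairing s (acc s) (acc s)) has_real_derivative vertical_pairing t (acc t) B) (at t)"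
    using vertical_equation[OF t acc_deriv[OF t] q] by (simp add: geo B_def J_self[OF Ut])
  obtain D where D: "((\<lambda>s. J (x s) *v v s) has_vector_derivative D) (at t)"
    "D + christoffel_form h (x t) (v t) (J (x t) *v v t) = J (x t) *v acc t"
    unfolding acceleration_def by (rule has_vector_derivative_J[OF x_deriv[OF t] Ut v_deriv[OF t]])
  \<comment> \<open>J is parallel, so \<nabla>(J\<gamma>') = Ja, whose product with a
    vanishes.\<close>
  have \<nu>: "(\<nu> has_real_derivative B \<bullet> (h (x t) *v (J (x t) *v v t))) (at t)"
    using has_real_derivative_inner_metric[OF x_deriv[OF t] Ut acc_deriv[OF t] D(1)]
    by (simp add: D(2) J_self[OF Ut] B_def)
  have N: "((\<lambda>s. acc s \<bullet> (h (x s) *v acc s)) has_real_derivative 2 * (acc t \<bullet> (h (x t) *v B))) (at t)"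
    using has_real_derivative_inner_metric[OF x_deriv[OF t] Ut acc_deriv[OF t] acc_deriv[OF t]]
    by (simp add: B_def[symmetric] h_commute[OF Ut, of B])
  have "((\<lambda>s. acc s \<bullet> (h (x s) *v acc s) + \<delta>\<^sup>2 * (\<nu> s * \<nu> s)) has_real_derivative 2 * vertical_pairing t (acc t) B) (at t)"
    by (rule DERIV_cong[OF DERIV_add[OF N DERIV_cmult[OF DERIV_mult[OF \<nu> \<nu>]]]])
      (simp add: vertical_pairing_def algebra_simps)
  then have "((\<lambda>s. vertical_pairing s (acc s) (acc s)) has_real_derivative 2 * vertical_pairing t (acc t) B) (at t)"
    by (simp add: vertical_pairing_def mult.assoc)
  from DERIV_unique[OF 1 this] 1 show ?thesis
    by simp
qed

text \<open>The energy of the lift is |\<gamma>'|^2 plus the pairing of a with itself, and both are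
  stationary at t. Hence so is |\<gamma>'|^2, whose derivative is 2 g(a, \<gamma>').\<close>

lemma speed_constant:
  assumes t: "t \<in> T" and geo: "acceleration (bs \<delta>) z t = 0"
  shows "acc t \<bullet> (h (x t) *v v t) = 0"
proof -
  note Ut = x_mem[OF t]
  obtain a where z': "(z' has_vector_derivative a) (at t)"
    and acc_z: "acceleration (bs \<delta>) z t = a + christoffel_form (bs \<delta>) (z t) (z' t) (z' t)"
    by (rule z'_deriv[OF t])
  have "((\<lambda>s. z' s \<bullet> (bs \<delta> (z s) *v z' s)) has_real_derivative 0) (at t)"
    using kinetic_energy_derivative[OF z_deriv[OF t] z' bs_z[OF t]]
    unfolding acc_z[symmetric] geo by simp
  then have "((\<lambda>s. v s \<bullet> (h (x s) *v v s) + vertical_pairing s (acc s) (acc s)) has_real_derivative 0) (at t)"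
  proof (rule has_field_derivative_transform_within_open[OF _ open_T t])
    fix s assume s: "s \<in> T"
    show "z' s \<bullet> (bs \<delta> (z s) *v z' s) = v s \<bullet> (h (x s) *v v s) + vertical_pairing s (acc s) (acc s)"
      unfolding bs_z_velocity[OF s] vertical_z_velocity[OF s] cometric_flat_J[OF s] cometric_flat[OF x_mem[OF s]]
      by (simp add: vertical_pairing_def)
  qed
  from DERIV_diff[OF this vertical_pairing_acc_constant[OF assms]]
  have "((\<lambda>s. v s \<bullet> (h (x s) *v v s)) has_real_derivative 0) (at t)"
    by simp
  then have "2 * (acc t \<bullet> (h (x t) *v v t)) = 0"
  proof (rule DERIV_unique[rotated])
    show "((\<lambda>s. v s \<bullet> (h (x s) *v v s)) has_real_derivative 2 * (acc t \<bullet> (h (x t) *v v t))) (at t)"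
    using has_real_derivative_inner_metric[OF x_deriv[OF t] Ut v_deriv[OF t] v_deriv[OF t]]
    by (simp add: acceleration_def[symmetric] h_commute[OF Ut, of "v t" "acc t"])
  qed
  then show ?thesis by simp
qed

lemma lift_geodesic_imp_geodesic:
  assumes geo: "\<And>t. t \<in> T \<Longrightarrow> acceleration (bs \<delta>) z t = 0" and t: "t \<in> T"
  shows "acc t = 0"
proof -
  note Ut = x_mem[OF t]
  \<comment> \<open>For Y = \<gamma>' the covariant derivative of Y is a, and the pJ term
    contributes a second copy of \<open>\<delta>\<^sup>2 * \<nu> t * \<nu> t\<close>.\<close>
  have "((\<lambda>s. vertical_pairing s (acc s) (v s)) has_real_derivative
      vertical_pairing t (acc t) (acc t) + \<delta>\<^sup>2 * \<nu> t * \<nu> t) (at t)"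
    using vertical_equation[OF t v_deriv[OF t] p_deriv[OF t]]
    by (simp add: geo[OF t] acceleration_def[symmetric])
  \<comment> \<open>The pairing is g(a, \<gamma>') plus a multiple of g(\<gamma>', J\<gamma>'),
    hence zero throughout T; this uses the geodesic equation on a whole neighbourhood of t.\<close>
  moreover have "((\<lambda>s. vertical_pairing s (acc s) (v s)) has_real_derivative 0) (at t)"
  proof (rule has_field_derivative_transform_within_open[OF DERIV_const[of 0] open_T t])
    show "0 = vertical_pairing s (acc s) (v s)" if "s \<in> T" for s
      using speed_constant[OF that geo[OF that]] J_self[OF x_mem[OF that]] by (simp add: vertical_pairing_def)
  qed
  ultimately have "vertical_pairing t (acc t) (acc t) + \<delta>\<^sup>2 * \<nu> t * \<nu> t = 0"
    by (rule DERIV_unique)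
  moreover have "\<delta>\<^sup>2 * \<nu> t * \<nu> t \<ge> 0"
    by (simp add: mult.assoc)
  ultimately have "acc t \<bullet> (h (x t) *v acc t) \<le> 0"
    unfolding vertical_pairing_def by linarith
  then show ?thesis
    using pos[OF Ut, of "acc t"] by (auto simp: not_less)
qed

text \<open>The test vector W is constant in coordinates. For horizontal velocity its product with W
  and the derivative of the metric along W both reduce to those of \<gamma> with the base part of
  W.\<close>

lemma geodesic_imp_lift_geodesic:
  assumes geo: "\<And>t. t \<in> T \<Longrightarrow> acc t = 0" and t: "t \<in> T"
  shows "acceleration (bs \<delta>) z t = 0"
proof -
  note Ut = x_mem[OF t]
  obtain a where z': "(z' has_vector_derivative a) (at t)"
    and acc_z: "acceleration (bs \<delta>) z t = a + christoffel_form (bs \<delta>) (z t) (z' t) (z' t)"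
    by (rule z'_deriv[OF t])
  have "W \<bullet> (bs \<delta> (z t) *v acceleration (bs \<delta>) z t) = 0" for W
  proof -
    let ?X = "base_part W"
    have "((\<lambda>s. z' s \<bullet> (bs \<delta> (z s) *v W)) has_real_derivative
        W \<bullet> (bs \<delta> (z t) *v acceleration (bs \<delta>) z t)
        + z' t \<bullet> (frechet_derivative (bs \<delta>) (at (z t)) W *v z' t) / 2) (at t)"
      using euler_lagrange[OF z_deriv[OF t] z' has_vector_derivative_const[of W] bs_z[OF t]]
      by (simp add: acc_z)
    moreover have "z' t \<bullet> (frechet_derivative (bs \<delta>) (at (z t)) W *v z' t) =
        v t \<bullet> (frechet_derivative h (at (x t)) ?X *v v t)"
      using horizontal_quadratic_derivative[OF Ut, of "p t" "z' t" \<delta> W]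
      by (simp add: vertical_z_velocity[OF t] geo[OF t])
    moreover have "((\<lambda>s. z' s \<bullet> (bs \<delta> (z s) *v W)) has_real_derivative
        v t \<bullet> (frechet_derivative h (at (x t)) ?X *v v t) / 2) (at t)"
    proof (rule has_field_derivative_transform_within_open[OF _ open_T t])
      \<comment> \<open>The Euler-Lagrange equation of \<gamma> itself, with a = 0.\<close>
      show "((\<lambda>s. v s \<bullet> (h (x s) *v ?X)) has_real_derivative
          v t \<bullet> (frechet_derivative h (at (x t)) ?X *v v t) / 2) (at t)"
        using euler_lagrange[OF x_deriv[OF t] v_deriv[OF t] has_vector_derivative_const[of ?X]
            h_differentiable[OF Ut] h_invertible[OF Ut] sym[OF Ut]] geo[OF t]
        by (simp add: acceleration_def)
      show "v s \<bullet> (h (x s) *v ?X) = z' s \<bullet> (bs \<delta> (z s) *v W)" if "s \<in> T" for s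
        unfolding bs_z_velocity[OF that]
        by (simp add: geo[OF that] bilinear_lzero[OF bilinear_cometric])
    qed
    ultimately show ?thesis
      by (auto dest: DERIV_unique)
  qed
  \<comment> \<open>Taking W to be the vector itself makes its Euclidean square vanish.\<close>
  from this[of "bs \<delta> (z t) *v acceleration (bs \<delta>) z t"]
  have "bs \<delta> (z t) *v acceleration (bs \<delta>) z t = 0"
    by simp
  with matrix_inv_vector(2)[OF bs_z(2)[OF t], of "acceleration (bs \<delta>) z t"] show ?thesis
    by simp
qed

end

section \<open>From charts to the manifold\<close>

lemma vector_derivative_cong_open:
  assumes "open T" "t \<in> T" "\<And>s. s \<in> T \<Longrightarrow> x s = y s"
  shows "vector_derivative x (at t) = vector_derivative y (at t)"
proof (rule vector_derivative_cong_eq)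
  show "\<forall>\<^sub>F s in nhds t. s \<in> UNIV \<longrightarrow> x s = y s"
    by (rule eventually_mono[OF eventually_nhds_in_open[OF assms(1,2)]]) (simp add: assms(3))
qed auto

lemma acceleration_cong:
  assumes "open T" "t \<in> T" "\<And>s. s \<in> T \<Longrightarrow> x s = y s"
  shows "acceleration h x t = acceleration h y t"
proof -
  have v: "vector_derivative x (at s) = vector_derivative y (at s)" if "s \<in> T" for s
    using vector_derivative_cong_open[OF assms(1) that assms(3)] .
  then have "vector_derivative (\<lambda>s. vector_derivative x (at s)) (at t) =
      vector_derivative (\<lambda>s. vector_derivative y (at s)) (at t)"
    by (rule vector_derivative_cong_open[OF assms(1,2)])
  then show ?thesis
    by (simp add: acceleration_def v[OF assms(2)] assms(3)[OF assms(2)])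
qed

text \<open>\<open>velocity\<close> has the default value 0 outside the chart, so it is the
  coordinate derivative only while the curve is inside; as these times form an open set, the
  derivatives at t agree.\<close>

lemma covariant_acceleration_eq:
  assumes T: "open {t \<in> I. \<gamma> t \<in> chart_dom A i}" and t: "t \<in> I" "\<gamma> t \<in> chart_dom A i"
  shows "covariant_acceleration A g \<gamma> t i = acceleration (g i) (chart_map A i \<circ> \<gamma>) t"
proof -
  have vel: "velocity A \<gamma> s i = vector_derivative (chart_map A i \<circ> \<gamma>) (at s)" if "\<gamma> s \<in> chart_dom A i" for s
    using that by (simp add: velocity_def)
  have "vector_derivative (\<lambda>s. velocity A \<gamma> s i) (at t) =
      vector_derivative (\<lambda>s. vector_derivative (chart_map A i \<circ> \<gamma>) (at s)) (at t)"
    by (rule vector_derivative_cong_open[OF T]) (use t vel in auto)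
  then show ?thesis
    unfolding covariant_acceleration_def acceleration_def christoffel_form_def vec_eq_iff vel[OF t(2)]
    by simp
qed

lemma smooth_curve_domain_open: "smooth_curve A I \<gamma> \<Longrightarrow> open {t \<in> I. \<gamma> t \<in> chart_dom A i}"
  by (simp add: smooth_curve_def)

text \<open>Interchanging the quantifiers splits the geodesic equation into one statement per chart,
  about a coordinate curve on a fixed set of times.\<close>

lemma geodesic_iff:
  "geodesic A g I \<gamma> \<longleftrightarrow> smooth_curve A I \<gamma> \<and>
    (\<forall>i. \<forall>t\<in>{t \<in> I. \<gamma> t \<in> chart_dom A i}. acceleration (g i) (chart_map A i \<circ> \<gamma>) t = 0)"
proof (cases "smooth_curve A I \<gamma>")
  case True
  note eq = covariant_acceleration_eq[OF smooth_curve_domain_open[OF True]]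
  show ?thesis
    unfolding geodesic_def
  proof (intro conj_cong refl iffI allI ballI impI)
    fix i t
    assume *: "\<forall>t\<in>I. \<forall>i. \<gamma> t \<in> chart_dom A i \<longrightarrow> covariant_acceleration A g \<gamma> t i = 0"
      and "t \<in> {t \<in> I. \<gamma> t \<in> chart_dom A i}"
    then have t: "t \<in> I" "\<gamma> t \<in> chart_dom A i" by auto
    with * have "covariant_acceleration A g \<gamma> t i = 0" by blast
    with eq[OF t] show "acceleration (g i) (chart_map A i \<circ> \<gamma>) t = 0" by (rule trans[OF sym])
  next
    fix t i
    assume *: "\<forall>i. \<forall>t\<in>{t \<in> I. \<gamma> t \<in> chart_dom A i}. acceleration (g i) (chart_map A i \<circ> \<gamma>) t = 0"
      and t: "t \<in> I" "\<gamma> t \<in> chart_dom A i"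
    from * t have "acceleration (g i) (chart_map A i \<circ> \<gamma>) t = 0" by blast
    with eq[OF t] show "covariant_acceleration A g \<gamma> t i = 0" by (rule trans)
  qed
qed (simp add: geodesic_def)

text \<open>The chain rule for the transition map, on the open set of times at which the curve lies
  in both charts.\<close>

lemma velocity_chart_change:
  fixes A :: "('i, 'a, 'n::finite) atlas"
  assumes A: "smooth_manifold A" and \<gamma>: "smooth_curve A I \<gamma>"
    and t: "t \<in> I" "\<gamma> t \<in> chart_dom A i" "\<gamma> t \<in> chart_dom A j"
  shows "velocity A \<gamma> t j = chart_change A i j (\<gamma> t) *v velocity A \<gamma> t i"
proof -
  let ?x = "\<lambda>i. chart_map A i \<circ> \<gamma>" and ?\<tau> = "transition A i j"
  let ?T = "\<lambda>i. {t \<in> I. \<gamma> t \<in> chart_dom A i}"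
  have inj: "inj_on (chart_map A i) (chart_dom A i)"
    using A by (simp add: smooth_manifold_def)
  have "smooth_on ?\<tau> (chart_map A i ` (chart_dom A i \<inter> chart_dom A j))"
    using A by (simp add: smooth_manifold_def)
  then have \<tau>: "?\<tau> differentiable (at (?x i t))"
    by (rule smooth_on_differentiable) (use t in auto)
  have x: "(?x i has_vector_derivative vector_derivative (?x i) (at t)) (at t)"
    using \<gamma> t by (intro smooth_on_has_vector_derivative[of _ "?T i"]) (auto simp: smooth_curve_def)
  have "((\<lambda>s. ?\<tau> (?x i s)) has_vector_derivative
      frechet_derivative ?\<tau> (at (?x i t)) (vector_derivative (?x i) (at t))) (at t)"
    using x \<tau> by (rule has_vector_derivative_compose)
  then have "(?x j has_vector_derivative
      frechet_derivative ?\<tau> (at (?x i t)) (vector_derivative (?x i) (at t))) (at t)"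
  proof (rule has_vector_derivative_transform_within_open)
    show "open (?T i \<inter> ?T j)"
      using \<gamma> by (intro open_Int smooth_curve_domain_open)
    show "?\<tau> (?x i s) = ?x j s" if "s \<in> ?T i \<inter> ?T j" for s
      using that by (simp add: transition_def inv_into_f_f[OF inj])
  qed (use t in auto)
  then have "vector_derivative (?x j) (at t) =
      frechet_derivative ?\<tau> (at (?x i t)) (vector_derivative (?x i) (at t))"
    by (rule vector_derivative_at)
  then show ?thesis
    using t fun_cong[OF matrix_vector_mul(2)[OF linear_frechet_derivative[OF \<tau>]], of "vector_derivative (?x i) (at t)"]
    by (simp add: velocity_def chart_change_def jacobian_def o_def)
qed

lemma vector_matrix_mult_symmetric:
  fixes M :: "real^'n^'n"
  assumes "transpose M = M"
  shows "X v* M = M *v X"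
  using transpose_matrix_vector[of M X] unfolding assms by (rule sym)

text \<open>In the transformation law of the metric the right factor \<open>chart_change\<close> is
  absorbed by the velocity; the transposed left factor is the one required of covectors.\<close>

lemma flat_velocity_in_cotangent_space:
  fixes A :: "('i, 'a, 'n::finite) atlas"
  assumes A: "smooth_manifold A" and \<gamma>: "smooth_curve A I \<gamma>" and g: "riemannian_metric A g"
    and t: "t \<in> I"
  shows "flat A g (\<gamma> t) (velocity A \<gamma> t) \<in> cotangent_space A (\<gamma> t)"
  unfolding cotangent_space_def
proof (intro CollectI conjI allI impI)
  fix i j assume ij: "\<gamma> t \<in> chart_dom A i \<inter> chart_dom A j"
  let ?D = "chart_change A i j (\<gamma> t)" and ?h = "\<lambda>k. g k (chart_map A k (\<gamma> t))"
  have sym: "transpose (?h k) = ?h k" if "\<gamma> t \<in> chart_dom A k" for k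
    using g imageI[OF that, of "chart_map A k"] unfolding riemannian_metric_def chart_image_def by blast
  have flat: "flat A g (\<gamma> t) (velocity A \<gamma> t) k = ?h k *v velocity A \<gamma> t k" if "\<gamma> t \<in> chart_dom A k" for k
    using that vector_matrix_mult_symmetric[OF sym[OF that]] by (simp add: flat_def)
  have "?h i = transpose ?D ** ?h j ** ?D"
    using g ij unfolding riemannian_metric_def by blast
  then have "?h i *v velocity A \<gamma> t i = transpose ?D *v (?h j *v (?D *v velocity A \<gamma> t i))"
    unfolding matrix_vector_mul_assoc by (simp only: matrix_mul_assoc)
  with ij show "flat A g (\<gamma> t) (velocity A \<gamma> t) i = transpose ?D *v flat A g (\<gamma> t) (velocity A \<gamma> t) j"
    by (simp only: flat velocity_chart_change[OF A \<gamma> t, of i j] Int_iff)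
qed (simp add: flat_def)

lemma kaehler_curve_in_chart:
  assumes "kaehler_manifold A J g" "smooth_curve A I \<gamma>"
  shows "kaehler_curve (chart_image A i) (g i) (J i) {t \<in> I. \<gamma> t \<in> chart_dom A i} (chart_map A i \<circ> \<gamma>)"
proof unfold_locales
  let ?U = "chart_image A i" and ?T = "{t \<in> I. \<gamma> t \<in> chart_dom A i}"
  have A: "smooth_manifold A" and J: "endomorphism_field A J" and g: "riemannian_metric A g"
    and K: "\<And>x. x \<in> ?U \<Longrightarrow> J i x ** J i x = - mat 1 \<and>
        (\<forall>X Y. (J i x *v X) \<bullet> (g i x *v (J i x *v Y)) = X \<bullet> (g i x *v Y)) \<and>
        (\<forall>k a b. covariant_deriv_endo (g i) (J i) x k a b = 0)"
    using assms(1) unfolding kaehler_manifold_def by blast+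
  show "open ?U" using A unfolding smooth_manifold_def by blast
  show "smooth_on (g i) ?U" using g unfolding riemannian_metric_def by blast
  show "smooth_on (J i) ?U" using J unfolding endomorphism_field_def by blast
  show "transpose (g i x) = g i x" if "x \<in> ?U" for x
    using g that unfolding riemannian_metric_def by blast
  show "X \<bullet> (g i x *v X) > 0" if "x \<in> ?U" "X \<noteq> 0" for x X
    using g that unfolding riemannian_metric_def by blast
  show "J i x ** J i x = - mat 1" if "x \<in> ?U" for x
    using K[OF that] by blast
  show "(J i x *v X) \<bullet> (g i x *v (J i x *v Y)) = X \<bullet> (g i x *v Y)" if "x \<in> ?U" for x X Y
    using K[OF that] by blast
  show "covariant_deriv_endo (g i) (J i) x k a b = 0" if "x \<in> ?U" for x k a b
    using K[OF that] by blast
  show "open ?T" "smooth_on (chart_map A i \<circ> \<gamma>) ?T"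
    using assms(2) unfolding smooth_curve_def by blast+
  show "(chart_map A i \<circ> \<gamma>) ` ?T \<subseteq> ?U"
    by (auto simp: chart_image_def)
qed

theorem corollary5p4:
  fixes A :: "('i, 'a, 'n::finite) atlas"
    and J g :: "'i \<Rightarrow> real^'n \<Rightarrow> real^'n^'n"
    and \<delta> :: real
    and m :: nat
    and I :: "real set"
    and \<gamma> :: "real \<Rightarrow> 'a"
  assumes "kaehler_manifold A J g"
    and "CARD('n) = 2 * m"
    and "open I" and "is_interval I"
    and "smooth_curve A I \<gamma>"
  shows "geodesic (cotangent_bundle A) (berger_sasaki_metric J g \<delta>) I
           (\<lambda>t. (\<gamma> t, flat A g (\<gamma> t) (velocity A \<gamma> t)))
         \<longleftrightarrow> geodesic A g I \<gamma>"
proof -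
  let ?C = "\<lambda>t. (\<gamma> t, flat A g (\<gamma> t) (velocity A \<gamma> t))"
  let ?T = "\<lambda>i. {t \<in> I. \<gamma> t \<in> chart_dom A i}"
  let ?x = "\<lambda>i. chart_map A i \<circ> \<gamma>"
  let ?G = "berger_sasaki_metric J g \<delta>"
  let ?z = "\<lambda>i t. join (?x i t) (g i (?x i t) *v vector_derivative (?x i) (at t))"
  have A: "smooth_manifold A" and g: "riemannian_metric A g"
    using assms(1) unfolding kaehler_manifold_def by blast+
  note open_T = smooth_curve_domain_open[OF assms(5)]
  \<comment> \<open>A chart domain of the bundle also requires a compatible covector; the lift
    always supplies one, so the times are those of \<gamma>.\<close>
  have dom: "{t \<in> I. ?C t \<in> chart_dom (cotangent_bundle A) i} = ?T i" for i
    by (auto simp: cotangent_bundle_def flat_velocity_in_cotangent_space[OF A assms(5) g])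
  \<comment> \<open>\<open>flat\<close> uses the row product, the chart computation the column
    product; symmetry of the metric reconciles them, and the default values 0 do not occur in
    \<open>?T i\<close>.\<close>
  have z: "?z i t = (chart_map (cotangent_bundle A) i \<circ> ?C) t" if "t \<in> ?T i" for i t
  proof -
    have "transpose (g i (?x i t)) = g i (?x i t)"
      using g that unfolding riemannian_metric_def chart_image_def o_def by blast
    from vector_matrix_mult_symmetric[OF this] that show ?thesis
      by (simp add: cotangent_bundle_def flat_def velocity_def)
  qed
  have curve: "smooth_curve (cotangent_bundle A) I ?C"
    unfolding smooth_curve_def
  proof (intro conjI allI)
    show "?C ` I \<subseteq> points (cotangent_bundle A)"
    proof (rule image_subsetI)
      fix t assume "t \<in> I"
      with assms(5) obtain i where "t \<in> ?T i"
        unfolding smooth_curve_def points_def by blast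
      then have "?C t \<in> chart_dom (cotangent_bundle A) i"
        unfolding dom[symmetric] by blast
      then show "?C t \<in> points (cotangent_bundle A)"
        unfolding points_def by blast
    qed
    fix i
    interpret kaehler_curve "chart_image A i" "g i" "J i" "?T i" "?x i" \<delta>
      by (rule kaehler_curve_in_chart[OF assms(1,5)])
    show "open {t \<in> I. ?C t \<in> chart_dom (cotangent_bundle A) i}"
      unfolding dom by (rule open_T)
    show "smooth_on (chart_map (cotangent_bundle A) i \<circ> ?C) {t \<in> I. ?C t \<in> chart_dom (cotangent_bundle A) i}"
      unfolding dom smooth_on_def
    proof
      show "Ck_on k (chart_map (cotangent_bundle A) i \<circ> ?C) (?T i)" for k
        by (rule Ck_on_cong[OF open_T z smooth_z[unfolded smooth_on_def, rule_format]])
    qed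
  qed
  have "(\<forall>t\<in>?T i. acceleration (?G i) (chart_map (cotangent_bundle A) i \<circ> ?C) t = 0) \<longleftrightarrow>
      (\<forall>t\<in>?T i. acceleration (g i) (?x i) t = 0)" for i
  proof -
    interpret kaehler_curve "chart_image A i" "g i" "J i" "?T i" "?x i" \<delta>
      by (rule kaehler_curve_in_chart[OF assms(1,5)])
    \<comment> \<open>Only the components in chart i enter the metric at index i, so the index type
      can be replaced by \<open>unit\<close>.\<close>
    have G: "?G i = berger_sasaki_metric (\<lambda>_::unit. J i) (\<lambda>_. g i) \<delta> ()"
      by (simp add: berger_sasaki_metric_def fun_eq_iff)
    have "acceleration (?G i) (chart_map (cotangent_bundle A) i \<circ> ?C) t =
        acceleration (berger_sasaki_metric (\<lambda>_::unit. J i) (\<lambda>_. g i) \<delta> ()) (?z i) t" if "t \<in> ?T i" for t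
      unfolding G by (rule acceleration_cong[OF open_T that z[symmetric]])
    then have "(\<forall>t\<in>?T i. acceleration (?G i) (chart_map (cotangent_bundle A) i \<circ> ?C) t = 0) \<longleftrightarrow>
      (\<forall>t\<in>?T i. acceleration (berger_sasaki_metric (\<lambda>_::unit. J i) (\<lambda>_. g i) \<delta> ()) (?z i) t = 0)"
      by (intro ball_cong refl) (simp only:)
    also have "\<dots> \<longleftrightarrow> (\<forall>t\<in>?T i. acceleration (g i) (?x i) t = 0)"
      by (intro iffI ballI) (rule lift_geodesic_imp_geodesic geodesic_imp_lift_geodesic; blast)+
    finally show ?thesis .
  qed
  then show ?thesis
    unfolding geodesic_iff dom by (simp only: curve assms(5))
qed

end
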